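(* Let $M$ be a planar map whose underlying graph contains a subdivision of $K_{2,3}$ (as a subgraph). Then $\dim(\mathbf{P}_{VEF}(M)) > 3$.
   Context: A planar map $M=(G,D)$ consists of a finite planar multigraph $G$ together with a plane drawing $D$ of $G$; it determines the set $V$ of vertices, the set $E$ of edges, the set $F$ of faces and the incidence relations among them. The vertex-edge-face poset $\mathbf{P}_{VEF}(M)$ is the poset on $V\cup E\cup F$ ordered by incidence/inclusion (a vertex is below each edge of which it is an endpoint and below each face on whose boundary it lies; an edge is below each face on whose boundary it lies). The dimension of a finite poset is the minimum number of linear orders on its ground set whose intersection is the poset's order. *)

theory Defs
  imports "HOL-Analysis.Analysis" "HOL-Library.Extended_Nat"
begin

section \<open>Multigraphs and subdivisions\<close>

text \<open>Edges have an identity of their own, so parallel edges are possible; an edge with a single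
  end is a loop.\<close>

record ('v, 'e) multigraph =
  verts :: "'v set"
  edges :: "'e set"
  ends  :: "'e \<Rightarrow> 'v set"

locale finite_multigraph =
  fixes G :: "('v, 'e) multigraph" (structure)
  assumes finite_verts: "finite (verts G)"
    and finite_edges: "finite (edges G)"
    and ends_subset: "e \<in> edges G \<Longrightarrow> ends G e \<subseteq> verts G"
    and card_ends: "e \<in> edges G \<Longrightarrow> card (ends G e) \<in> {1, 2}"

definition subgraph :: "('v, 'e) multigraph \<Rightarrow> ('v, 'e) multigraph \<Rightarrow> bool" where
  "subgraph H G \<longleftrightarrow> finite_multigraph H \<and> verts H \<subseteq> verts G \<and> edges H \<subseteq> edges G \<and>
     (\<forall>e\<in>edges H. ends H e = ends G e)"

definition graph_path :: "('v, 'e) multigraph \<Rightarrow> 'v list \<Rightarrow> 'e list \<Rightarrow> bool" where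
  "graph_path G xs es \<longleftrightarrow>
     length xs = Suc (length es) \<and> distinct xs \<and> set xs \<subseteq> verts G \<and> set es \<subseteq> edges G \<and>
     (\<forall>i<length es. ends G (es ! i) = {xs ! i, xs ! Suc i})"

definition inner_verts :: "'v list \<Rightarrow> 'v set" where
  "inner_verts xs = set xs - {hd xs, last xs}"

text \<open>\<open>H\<close> arises from the loopless graph \<open>X\<close> by replacing every edge \<open>e\<close> of \<open>X\<close> with a path
  \<open>(P e, Q e)\<close> (its vertex list and its edge list) between the images of the ends of \<open>e\<close>, where no
  path has an inner vertex on another path or among the branch vertices \<open>b x\<close>.\<close>

definition is_subdivision :: "('v, 'e) multigraph \<Rightarrow> ('x, 'y) multigraph \<Rightarrow> bool" where
  "is_subdivision H X \<longleftrightarrow>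
     (\<exists>(b :: 'x \<Rightarrow> 'v) (P :: 'y \<Rightarrow> 'v list) (Q :: 'y \<Rightarrow> 'e list).
        inj_on b (verts X) \<and>
        (\<forall>e\<in>edges X. graph_path H (P e) (Q e) \<and> {hd (P e), last (P e)} = b ` ends X e \<and>
           inner_verts (P e) \<inter> b ` verts X = {}) \<and>
        (\<forall>e\<in>edges X. \<forall>e'\<in>edges X. e \<noteq> e' \<longrightarrow>
           inner_verts (P e) \<inter> inner_verts (P e') = {} \<and> set (Q e) \<inter> set (Q e') = {}) \<and>
        verts H = b ` verts X \<union> (\<Union>e\<in>edges X. set (P e)) \<and>
        edges H = (\<Union>e\<in>edges X. set (Q e)))"

definition complete_bipartite :: "nat \<Rightarrow> nat \<Rightarrow> (nat + nat, nat \<times> nat) multigraph" where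
  "complete_bipartite m n =
     \<lparr>verts = Inl ` {..<m} \<union> Inr ` {..<n}, edges = {..<m} \<times> {..<n},
      ends = (\<lambda>(i, j). {Inl i, Inr j})\<rparr>"

lemma finite_multigraph_complete_bipartite: "finite_multigraph (complete_bipartite m n)"
  by unfold_locales (auto simp: complete_bipartite_def)


section \<open>Planar maps\<close>

text \<open>The plane is \<^typ>\<open>complex\<close>. A drawing places each vertex at a point and draws each edge
  as a curve on \<open>[0, 1]\<close>.\<close>

record ('v, 'e) drawing =
  point :: "'v \<Rightarrow> complex"
  curve :: "'e \<Rightarrow> real \<Rightarrow> complex"

text \<open>A simple path may be closed, so an edge with two ends is drawn as an arc and a loop as a
  simple closed curve.\<close>

locale planar_map = finite_multigraph G for G :: "('v, 'e) multigraph" (structure) +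
  fixes D :: "('v, 'e) drawing"
  assumes inj_point: "inj_on (point D) (verts G)"
    and simple_curve: "e \<in> edges G \<Longrightarrow> simple_path (curve D e)"
    and curve_ends:
      "e \<in> edges G \<Longrightarrow> {pathstart (curve D e), pathfinish (curve D e)} = point D ` ends G e"
    and curve_avoids_verts:
      "e \<in> edges G \<Longrightarrow> curve D e ` {0<..<1} \<inter> point D ` verts G = {}"
    and curves_disjoint:
      "e \<in> edges G \<Longrightarrow> e' \<in> edges G \<Longrightarrow> e \<noteq> e' \<Longrightarrow>
         curve D e ` {0<..<1} \<inter> curve D e' ` {0<..<1} = {}"

definition drawn_set :: "('v, 'e) multigraph \<Rightarrow> ('v, 'e) drawing \<Rightarrow> complex set" where
  "drawn_set G D = point D ` verts G \<union> (\<Union>e\<in>edges G. path_image (curve D e))"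

definition faces :: "('v, 'e) multigraph \<Rightarrow> ('v, 'e) drawing \<Rightarrow> complex set set" where
  "faces G D = components (- drawn_set G D)"


section \<open>The vertex-edge-face poset\<close>

datatype ('v, 'e) cell = Vertex 'v | Edge 'e | Face "complex set"

definition cells :: "('v, 'e) multigraph \<Rightarrow> ('v, 'e) drawing \<Rightarrow> ('v, 'e) cell set" where
  "cells G D = Vertex ` verts G \<union> Edge ` edges G \<union> Face ` faces G D"

fun incident_le ::
    "('v, 'e) multigraph \<Rightarrow> ('v, 'e) drawing \<Rightarrow> ('v, 'e) cell \<Rightarrow> ('v, 'e) cell \<Rightarrow> bool" where
  "incident_le G D (Vertex v) (Vertex w) \<longleftrightarrow> v = w"
| "incident_le G D (Vertex v) (Edge e) \<longleftrightarrow> v \<in> ends G e"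
| "incident_le G D (Vertex v) (Face f) \<longleftrightarrow> point D v \<in> frontier f"
| "incident_le G D (Edge e) (Edge e') \<longleftrightarrow> e = e'"
| "incident_le G D (Edge e) (Face f) \<longleftrightarrow> path_image (curve D e) \<subseteq> frontier f"
| "incident_le G D (Face f) (Face f') \<longleftrightarrow> f = f'"
| "incident_le G D _ _ \<longleftrightarrow> False"

definition P_VEF :: "('v, 'e) multigraph \<Rightarrow> ('v, 'e) drawing \<Rightarrow> ('v, 'e) cell rel" where
  "P_VEF G D = {(x, y). x \<in> cells G D \<and> y \<in> cells G D \<and> incident_le G D x y}"

lemma (in planar_map) partial_order_on_P_VEF: "partial_order_on (cells G D) (P_VEF G D)"
proof -
  have refl: "incident_le G D x x" for x by (cases x) auto
  have antisym: "x = y" if "incident_le G D x y" "incident_le G D y x" for x y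
    using that by (cases x; cases y) auto
  have on_frontier: "point D v \<in> frontier f"
    if "e \<in> edges G" "v \<in> ends G e" "path_image (curve D e) \<subseteq> frontier f" for v e f
  proof -
    have "point D v \<in> {pathstart (curve D e), pathfinish (curve D e)}"
      using curve_ends[OF that(1)] that(2) by simp
    then have "point D v \<in> path_image (curve D e)"
      using pathstart_in_path_image pathfinish_in_path_image by fastforce
    with that(3) show ?thesis by (rule subsetD)
  qed
  have trans: "incident_le G D x z"
    if "y \<in> cells G D" "incident_le G D x y" "incident_le G D y z" for x y z
  proof (cases y)
    case (Vertex v)
    with that show ?thesis by (cases x) auto
  next
    case (Edge e)
    with that have "e \<in> edges G" by (auto simp: cells_def)
    with that Edge show ?thesis using on_frontier[of e] by (cases x; cases z) simp_all
  next
    case (Face f)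
    with that show ?thesis by (cases z) auto
  qed
  have "P_VEF G D \<subseteq> cells G D \<times> cells G D" by (auto simp: P_VEF_def)
  moreover have "refl_on (cells G D) (P_VEF G D)"
    by (simp add: refl_on_def P_VEF_def refl)
  moreover have "trans (P_VEF G D)"
  proof (rule transI)
    fix x y z assume "(x, y) \<in> P_VEF G D" "(y, z) \<in> P_VEF G D"
    then show "(x, z) \<in> P_VEF G D" using trans[of y x z] by (simp add: P_VEF_def)
  qed
  moreover have "antisym (P_VEF G D)"
  proof (rule antisymI)
    fix x y assume "(x, y) \<in> P_VEF G D" "(y, x) \<in> P_VEF G D"
    then show "x = y" using antisym[of x y] by (simp add: P_VEF_def)
  qed
  ultimately show ?thesis by (simp add: partial_order_on_def preorder_on_def)
qed


section \<open>Order dimension\<close>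

definition realizer :: "'a set \<Rightarrow> 'a rel \<Rightarrow> 'a rel set \<Rightarrow> bool" where
  "realizer A r \<L> \<longleftrightarrow>
     finite \<L> \<and> \<L> \<noteq> {} \<and> (\<forall>L\<in>\<L>. linear_order_on A L) \<and> \<Inter> \<L> = r"

text \<open>Infinite if there is no finite realizer, which cannot happen for a finite poset.\<close>

definition order_dim :: "'a set \<Rightarrow> 'a rel \<Rightarrow> enat" where
  "order_dim A r = Inf {enat (card \<L>) | \<L>. realizer A r \<L>}"

end

theory Submission
  imports Defs "HOL-Complex_Analysis.Complex_Analysis"
begin

text \<open>
  Suppose three linear orders realize the poset. The ranks of the vertices give points of
  \<open>\<real>\<^sup>3\<close>; joining each end of an edge to the coordinatewise maximum of both ends and projecting
  along \<open>(1, 1, 1)\<close> yields a second plane drawing of the theta graph, because \<open>p = q + t (1, 1, 1)\<close>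
  with \<open>t \<ge> 0\<close> makes \<open>p\<close> dominate \<open>q\<close>. In that drawing one of the three paths lies inside the
  cycle formed by the other two, so this cycle \<open>C\<close> winds around every inner vertex \<open>x\<close> of the path.

  In the given drawing let \<open>\<Omega>\<close> be the side of \<open>C\<close> without \<open>x\<close>. No face in \<open>\<Omega>\<close> lies above \<open>x\<close>, so
  every such face is below \<open>x\<close> in one of the three orders. This covers the closure of \<open>\<Omega>\<close> by three
  closed sets, which have no common point because no cell other than \<open>x\<close> is below \<open>x\<close>. Hence the
  distances to the three sets define a nowhere vanishing function on the closure of \<open>\<Omega>\<close>; it has
  winding number \<open>0\<close> along \<open>C\<close>, and along \<open>C\<close> it is homotopic to the position of the second drawing
  relative to \<open>x\<close>, a contradiction.
\<close>

section \<open>Arcs on the boundary of a face\<close>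

text \<open>The two drawings of the theta graph need not look alike: the coordinates decide which
  path is enclosed, while the faces belong to the given curves, where \<open>x\<close> may lie on
  either side of \<open>C\<close>. They are compared along \<open>C\<close> only. For an edge
  \<open>e\<close> of \<open>C\<close>, some order puts a face of \<open>\<Omega>\<close> above
  \<open>e\<close> and below \<open>x\<close>; in this coordinate the distance is \<open>0\<close>
  and both ends of \<open>e\<close> rank below \<open>x\<close>. As vertices are incomparable,
  another coordinate of the edge point exceeds that of \<open>x\<close>. Hence no proper mixture of
  the two vectors is a multiple of \<open>(1, 1, 1)\<close>, and a straight-line homotopy avoids
  \<open>0\<close>.

  The topological obstacle is that an edge is incident with a face only if its whole curve lies on
  the frontier, and curves are merely continuous. A face that comes near one inner point of an edge
  must be shown to reach all of it. Only the theta subgraph is redrawn, because the new curves of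
  parallel edges would coincide and a loop would collapse to a point.\<close>

lemma interior_arc_image:
  fixes g :: "real \<Rightarrow> complex"
  assumes "arc g"
  shows "interior (path_image g) = {}"
proof (rule ccontr)
  assume ne: "interior (path_image g) \<noteq> {}"
  have "path_image g homeomorphic {0..1::real}"
    using homeomorphic_arc_image_interval[OF assms, of 0 1] by simp
  then obtain f k where "homeomorphism (path_image g) {0..1::real} f k"
    unfolding homeomorphic_def by blast
  then have "continuous_on (path_image g) f" "inj_on f (path_image g)"
    by (auto simp: homeomorphism_def intro: inj_on_inverseI)
  then have "continuous_on (interior (path_image g)) f" "inj_on f (interior (path_image g))"
    by (meson continuous_on_subset interior_subset inj_on_subset)+
  from invariance_of_dimension[OF this(1) open_interior this(2) ne] show False by simp
qed

text \<open>A closed simple path is not an arc, but cutting it at \<open>1/2\<close> leaves two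
  arcs, and a union of two closed sets with empty interior has empty interior.\<close>

lemma interior_simple_path_image:
  fixes g :: "real \<Rightarrow> complex"
  assumes "simple_path g"
  shows "interior (path_image g) = {}"
proof -
  have inj: "g 0 \<noteq> g (1/2)" "g (1/2) \<noteq> g 1"
    using simple_path_def[of g] assms unfolding loop_free_def by fastforce+
  have a: "arc (subpath 0 (1/2) g)" "arc (subpath (1/2) 1 g)"
    using arc_simple_path_subpath[OF assms] inj by auto
  have "g ` {0..1} = g ` {0..1/2} \<union> g ` {1/2..1}"
    by (simp add: image_Un[symmetric] ivl_disj_un_two_touch(4))
  then have "path_image g = path_image (subpath 0 (1/2) g) \<union> path_image (subpath (1/2) 1 g)"
    unfolding path_image_def[of g] by (simp add: path_image_subpath)
  then show ?thesis
    by (simp add: interior_closed_Un_empty_interior a interior_arc_image closed_arc_image)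
qed

lemma simple_path_inj_inner:
  assumes "simple_path g" "g x = g y" "0 < x" "x < 1" "0 \<le> y" "y \<le> 1"
  shows "x = y"
proof -
  have "x = y \<or> x = 0 \<and> y = 1 \<or> x = 1 \<and> y = 0"
    using assms unfolding simple_path_def loop_free_def by (metis atLeastAtMost_iff less_le)
  with assms show ?thesis by auto
qed

text \<open>Janiszewski's theorem for a short final piece of the arc and the union of the rest of the arc
  with the complement of a disc around the tip: they meet in a single point.\<close>

lemma tip_neighbourhood:
  fixes g :: "real \<Rightarrow> complex"
  assumes g: "simple_path g" and t: "0 < t" "t < 1" and B: "closed B" "g t \<notin> B"
  obtains r where "r > 0"
    "\<And>a b. \<lbrakk>a \<in> ball (g t) r - g ` {0..t}; b \<in> ball (g t) r - g ` {0..t}\<rbrakk> \<Longrightarrow>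
       connected_component (- (B \<union> g ` {0..t})) a b"
proof -
  have cont: "continuous_on {0..1} g"
    using g simple_path_imp_path path_def by blast
  have inj: "x = y" if "g x = g y" "x \<in> {0..t}" "y \<in> {0..t}" for x y
    using simple_path_inj_inner[OF g, of x y] simple_path_inj_inner[OF g, of y x] that t by force
  obtain R where R: "R > 0" "ball (g t) R \<inter> B = {}"
    using B openE[of "- B" "g t"] by (metis Compl_iff disjoint_eq_subset_Compl open_Compl)
  obtain d where d: "d > 0" "\<And>x. x \<in> {0..1} \<Longrightarrow> dist x t < d \<Longrightarrow> dist (g x) (g t) < R"
  proof -
    have "t \<in> {0..1}" using t by simp
    then show thesis using that cont R(1) unfolding continuous_on_iff by blast
  qed
  \<comment> \<open>Close enough to \<open>t\<close> for the final piece to stay in the disc of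
    radius \<open>R\<close>, which misses \<open>B\<close>; \<open>t/2\<close> keeps the cut point
    positive.\<close>
  define u where "u = max (t/2) (t - d/2)"
  have u: "0 < u" "u < t" "t - u < d" using t d by (auto simp: u_def max_def)
  define S where "S = g ` {u..t}"
  define T where "T = - ball (g t) R \<union> g ` {0..u}"
  have SR: "S \<subseteq> ball (g t) R"
    unfolding S_def using d(2) u t by (auto simp: dist_commute dist_real_def)
  have compS: "compact S" unfolding S_def
    using compact_continuous_image[OF continuous_on_subset[OF cont]] u t by auto
  have comp0: "compact (g ` {0..u})"
    using compact_continuous_image[OF continuous_on_subset[OF cont]] u t by auto
  have closT: "closed T" unfolding T_def using comp0 by (auto intro: compact_imp_closed)
  have "S \<inter> T = {g u}"
  proof
    show "S \<inter> T \<subseteq> {g u}"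
    proof
      fix z assume "z \<in> S \<inter> T"
      then have "z \<in> g ` {u..t}" "z \<in> g ` {0..u}"
        using SR unfolding S_def T_def by blast+
      then obtain x y where "z = g x" "x \<in> {u..t}" "z = g y" "y \<in> {0..u}" by blast
      with inj[of x y] u show "z \<in> {g u}" by force
    qed
    show "{g u} \<subseteq> S \<inter> T" using u by (auto simp: S_def T_def)
  qed
  then have ST: "connected (S \<inter> T)" by simp
  have "g t \<noteq> g x" if "x \<in> {0..u}" for x
    using inj[of t x] that u t by fastforce
  then have "g t \<notin> g ` {0..u}" by blast
  then have "g t \<notin> T"
    unfolding T_def using R(1) by simp
  then obtain r where r: "r > 0" "ball (g t) r \<subseteq> - T"
    using closT openE[of "- T" "g t"] by (auto simp: open_Compl)
  have "arc (subpath u t g)"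
  proof (rule arc_simple_path_subpath[OF g])
    show "g u \<noteq> g t" using inj[of u t] u by fastforce
  qed (use u t in auto)
  moreover have "path_image (subpath u t g) = S"
    using u by (simp add: path_image_subpath S_def)
  ultimately have conS: "connected (- S)"
    using path_connected_arc_complement path_connected_imp_connected by (metis DIM_complex order_refl)
  have un: "{0..u} \<union> {u..t} = {0..t}" using u by auto
  have STun: "S \<union> T = - ball (g t) R \<union> g ` {0..t}"
    unfolding S_def T_def un[symmetric] by auto
  show thesis
  proof
    show "r > 0" by fact
    fix a b assume ab: "a \<in> ball (g t) r - g ` {0..t}" "b \<in> ball (g t) r - g ` {0..t}"
    have "connected_component (- (S \<union> T)) a b"
    proof (rule Janiszewski[OF compS closT ST])
      show "connected_component (- S) a b"
        using conS ab un unfolding S_def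
        by (auto simp: connected_iff_connected_component)
      show "connected_component (- T) a b"
        unfolding connected_component_def using ab r(2) connected_ball by blast
    qed
    then show "connected_component (- (B \<union> g ` {0..t})) a b"
      by (rule connected_component_of_subset) (use R in \<open>auto simp: STun\<close>)
  qed
qed

text \<open>Otherwise let \<open>m\<close> be the last parameter in \<open>{t..t'}\<close> with
  \<open>g m\<close> in the closure. Near the tip \<open>g m\<close>, a point of \<open>F\<close>
  can be joined to some \<open>g y\<close> just beyond it, avoiding \<open>B\<close> and the curve
  outside the stretch from \<open>m\<close> to \<open>t'\<close>. Such a connected set could leave
  \<open>F\<close> only on that stretch, where no point is in the closure of
  \<open>F\<close>.\<close>

lemma edge_forward_in_closure:
  fixes g :: "real \<Rightarrow> complex"
  assumes g: "simple_path g" and B: "closed B" "g ` {0<..<1} \<inter> B = {}"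
    and F: "F \<in> components (- (B \<union> path_image g))"
    and t: "0 < t" "t < 1" "g t \<in> closure F" and t': "t \<le> t'" "t' \<le> 1"
  shows "g t' \<in> closure F"
proof (rule ccontr)
  assume no: "g t' \<notin> closure F"
  have cont: "continuous_on {0..1} g"
    using g simple_path_imp_path path_def by blast
  define Q where "Q = {x \<in> {t..t'}. g x \<in> closure F}"
  have "closed Q"
  proof -
    have "closed ({t..t'} \<inter> g -` closure F)"
      by (rule continuous_closed_preimage) (use continuous_on_subset[OF cont] t t' in auto)
    moreover have "Q = {t..t'} \<inter> g -` closure F" by (auto simp: Q_def)
    ultimately show ?thesis by simp
  qed
  moreover have "bounded Q" by (rule bounded_subset[of "{t..t'}"]) (auto simp: Q_def)
  ultimately have "compact Q" by (simp add: compact_eq_bounded_closed)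
  moreover have "t \<in> Q" using t t' by (auto simp: Q_def)
  ultimately obtain m where m: "m \<in> Q" "\<And>x. x \<in> Q \<Longrightarrow> x \<le> m"
    using compact_attains_sup[of Q] by blast
  have mt: "t \<le> m" "m < t'" "g m \<in> closure F"
    using m no by (auto simp: Q_def order_le_less)
  have m01: "0 < m" "m < 1" using mt t t' by auto
  \<comment> \<open>With the rest of the curve added to the obstacle, the connecting set can cross
    \<open>g\<close> only strictly between \<open>m\<close> and \<open>t'\<close>.\<close>
  define B' where "B' = B \<union> g ` {t'..1}"
  have "compact (g ` {t'..1})"
    using compact_continuous_image[OF continuous_on_subset[OF cont]] t t' by auto
  then have clB': "closed B'" using B unfolding B'_def by (simp add: compact_imp_closed closed_Un)
  have inj: "x = y" if "g x = g y" "x \<in> {0<..<1}" "y \<in> {0..1}" for x y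
    using simple_path_inj_inner[OF g, of x y] that by simp
  have "g m \<noteq> g x" if "x \<in> {t'..1}" for x
    using inj[of m x] that m01 mt t by fastforce
  then have "g m \<notin> g ` {t'..1}" by blast
  moreover have "g m \<notin> B" using B(2) m01 by (metis IntI empty_iff greaterThanLessThan_iff imageI)
  ultimately have gmB: "g m \<notin> B'"
    unfolding B'_def by simp
  obtain r where r: "r > 0"
    "\<And>a b. \<lbrakk>a \<in> ball (g m) r - g ` {0..m}; b \<in> ball (g m) r - g ` {0..m}\<rbrakk> \<Longrightarrow>
       connected_component (- (B' \<union> g ` {0..m})) a b"
    using tip_neighbourhood[OF g m01 clB' gmB] by blast
  have Fsub: "F \<subseteq> - (B \<union> path_image g)" using F in_components_subset by blast
  obtain a where a: "a \<in> F" "a \<in> ball (g m) r"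
    using mt(3) r(1) by (metis closure_approachable dist_commute mem_ball)
  obtain d where d: "d > 0" "\<And>x. x \<in> {0..1} \<Longrightarrow> dist x m < d \<Longrightarrow> dist (g x) (g m) < r"
  proof -
    have "m \<in> {0..1}" using m01 by simp
    then show thesis using that cont r(1) unfolding continuous_on_iff by blast
  qed
  define y where "y = min ((m + t')/2) (m + d/2)"
  have y: "m < y" "y < t'" "dist y m < d" using mt d by (auto simp: y_def dist_real_def min_def)
  have yn: "g y \<notin> closure F" using m(2)[of y] y mt by (auto simp: Q_def)
  have yb: "g y \<in> ball (g m) r - g ` {0..m}"
  proof -
    have "g y \<noteq> g x" if "x \<in> {0..m}" for x
      using inj[of y x] that m01 y t' by fastforce
    then have "g y \<notin> g ` {0..m}" by blast
    moreover have "g y \<in> ball (g m) r"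
      using d(2)[of y] y m01 t' by (simp add: dist_commute)
    ultimately show ?thesis by simp
  qed
  have ab: "a \<in> ball (g m) r - g ` {0..m}"
    using a Fsub m01 by (auto simp: path_image_def)
  from r(2)[OF ab yb] obtain C where C: "connected C" "C \<subseteq> - (B' \<union> g ` {0..m})" "a \<in> C" "g y \<in> C"
    unfolding connected_component_def by blast
  have frF: "frontier F \<subseteq> B \<union> path_image g"
    by (rule frontier_of_components_closed_complement[OF _ F])
      (simp add: B closed_Un closed_simple_path_image[OF g])
  have "C \<inter> frontier F = {}"
  proof (rule ccontr)
    assume "C \<inter> frontier F \<noteq> {}"
    then obtain z where z: "z \<in> C" "z \<in> frontier F" by blast
    then have "z \<in> closure F" by (simp add: frontier_def)
    from z frF C(2) have "z \<in> path_image g" by (auto simp: B'_def)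
    then obtain x where x: "x \<in> {0..1}" "z = g x" by (auto simp: path_image_def)
    with z C(2) have "m < x" "x < t'" by (force simp: B'_def)+
    with m(2)[of x] x \<open>z \<in> closure F\<close> mt show False by (auto simp: Q_def)
  qed
  then have "C \<subseteq> F" using connected_Int_frontier[OF C(1), of F] a C(3) by blast
  with C(4) yn closure_subset show False by blast
qed

text \<open>Parameters before \<open>t\<close> are handled by running the forward version along the
  reversed curve. Here \<open>B\<close> stands for everything drawn apart from one edge.\<close>

lemma edge_in_closure:
  fixes g :: "real \<Rightarrow> complex"
  assumes g: "simple_path g" and B: "closed B" "g ` {0<..<1} \<inter> B = {}"
    and F: "F \<in> components (- (B \<union> path_image g))"
    and t: "0 < t" "t < 1" "g t \<in> closure F"
  shows "path_image g \<subseteq> closure F"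
proof
  fix z assume "z \<in> path_image g"
  then obtain x where x: "x \<in> {0..1}" "z = g x" by (auto simp: path_image_def)
  show "z \<in> closure F"
  proof (cases "t \<le> x")
    case True
    then show ?thesis using edge_forward_in_closure[OF g B F t True] x by simp
  next
    case False
    have "reversepath g ` {0<..<1} \<inter> B = {}"
    proof -
      have "reversepath g ` {0<..<1} \<subseteq> g ` {0<..<1}"
        unfolding reversepath_def by (auto intro!: imageI)
      with B(2) show ?thesis by blast
    qed
    then have "reversepath g (1 - x) \<in> closure F"
      using edge_forward_in_closure[of "reversepath g" B F "1 - t" "1 - x"] g B F t x False
      by (simp add: simple_path_reversepath) (simp add: reversepath_def)
    then show ?thesis using x by (simp add: reversepath_def)
  qed
qed

section \<open>Logarithms and winding numbers on Jordan curves\<close>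

text \<open>Borsuk's criterion: a compact plane set with connected complement is Borsukian, so maps
  from it into the punctured plane are inessential.\<close>

lemma log_on_nonseparating_compact:
  fixes g :: "complex \<Rightarrow> complex"
  assumes "compact K" "connected (- K)" "continuous_on K g" "\<And>z. z \<in> K \<Longrightarrow> g z \<noteq> 0"
  obtains l where "continuous_on K l" "\<And>z. z \<in> K \<Longrightarrow> g z = exp (l z)"
proof -
  have "Borsukian K" using Borsukian_separation_compact assms by blast
  moreover have "g \<in> K \<rightarrow> - {0}" using assms by auto
  ultimately show ?thesis using that assms(3) unfolding Borsukian_continuous_logarithm by blast
qed

lemma log_on_loop_from_inside:
  fixes g :: "complex \<Rightarrow> complex"
  assumes c: "simple_path c" "pathfinish c = pathstart c"
    and g: "continuous_on (inside (path_image c) \<union> path_image c) g"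
      "\<And>z. z \<in> inside (path_image c) \<union> path_image c \<Longrightarrow> g z \<noteq> 0"
  obtains l where "continuous_on (path_image c) l" "\<And>z. z \<in> path_image c \<Longrightarrow> g z = exp (l z)"
proof -
  let ?K = "inside (path_image c) \<union> path_image c"
  note J = Jordan_inside_outside[OF c]
  have "closure (inside (path_image c)) = ?K"
    using J by (simp add: closure_Un_frontier)
  then have "compact ?K" using J by (metis compact_closure)
  moreover have "- ?K = outside (path_image c)" by (auto simp: outside_inside)
  ultimately obtain l where "continuous_on ?K l" "\<And>z. z \<in> ?K \<Longrightarrow> g z = exp (l z)"
    using log_on_nonseparating_compact[of ?K g] g J by auto
  then show ?thesis using that[of l] continuous_on_subset by blast
qed

text \<open>Inversion at an inner point reduces this to a compact set; the value near infinity extends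
  the function continuously over the new centre.\<close>

lemma log_on_loop_from_outside:
  fixes g :: "complex \<Rightarrow> complex"
  assumes c: "simple_path c" "pathfinish c = pathstart c"
    and g: "continuous_on (outside (path_image c) \<union> path_image c) g"
      "\<And>z. z \<in> outside (path_image c) \<union> path_image c \<Longrightarrow> g z \<noteq> 0"
    and inf: "\<And>z. z \<in> outside (path_image c) \<Longrightarrow> norm z \<ge> R \<Longrightarrow> g z = w"
  obtains l where "continuous_on (path_image c) l" "\<And>z. z \<in> path_image c \<Longrightarrow> g z = exp (l z)"
proof -
  let ?I = "inside (path_image c)" and ?O = "outside (path_image c)"
  note J = Jordan_inside_outside[OF c]
  obtain p where p: "p \<in> ?I" using J by blast
  define f where "f v = p + inverse v" for v :: complex
  \<comment> \<open>The inverted closed outside, with \<open>0\<close> in the role of the point at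
    infinity.\<close>
  define K where "K = {v. v = 0 \<or> f v \<in> ?O \<union> path_image c}"
  have ff: "f (inverse (z - p)) = z" for z by (simp add: f_def)
  have contf: "continuous_on (- {0}) f" unfolding f_def by (intro continuous_intros) auto
  have iio: "z \<in> ?I \<longleftrightarrow> z \<notin> ?O \<union> path_image c" for z
    using inside_no_overlap[of "path_image c"] unfolding outside_inside by blast
  have negK: "- K = - {0} \<inter> f -` ?I" using iio by (auto simp: K_def)
  have "open (- K)" unfolding negK
    by (rule continuous_open_preimage[OF contf]) (use J in auto)
  then have "closed K" by (simp add: closed_def)
  \<comment> \<open>This description yields connectedness: the inside stays connected when its point
    \<open>p\<close> is deleted.\<close>
  have "- K = (\<lambda>z. inverse (z - p)) ` (?I - {p})"
  proof
    show "- K \<subseteq> (\<lambda>z. inverse (z - p)) ` (?I - {p})"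
    proof
      fix v assume "v \<in> - K"
      then have "v \<noteq> 0" "f v \<in> ?I" by (auto simp: negK)
      then have "v = inverse (f v - p)" "f v \<in> ?I - {p}" by (auto simp: f_def)
      then show "v \<in> (\<lambda>z. inverse (z - p)) ` (?I - {p})" by blast
    qed
    show "(\<lambda>z. inverse (z - p)) ` (?I - {p}) \<subseteq> - K"
      by (auto simp: negK ff)
  qed
  moreover have "connected (?I - {p})" using J by (simp add: connected_open_delete)
  moreover have "continuous_on (?I - {p}) (\<lambda>z. inverse (z - p))"
    by (intro continuous_intros) auto
  ultimately have conK: "connected (- K)" using connected_continuous_image by metis
  obtain e where e: "e > 0" "ball p e \<subseteq> ?I" using J p openE by blast
  have "norm v \<le> 1 / e" if "v \<in> K" for v
  proof (rule ccontr)
    assume "\<not> norm v \<le> 1 / e"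
    then have v: "1 / e < norm v" "v \<noteq> 0" using e by auto
    have "inverse (norm v) < e" using v e by (simp add: field_simps)
    then have "f v \<in> ball p e" by (simp add: f_def dist_norm norm_inverse)
    then have "f v \<in> ?I" using e by blast
    then show False using that v(2) iio by (simp add: K_def)
  qed
  then have "bounded K" by (auto simp: bounded_iff)
  with \<open>closed K\<close> have compK: "compact K" by (simp add: compact_eq_bounded_closed)
  obtain M where M: "M > 0" "\<And>z. z \<in> path_image c \<Longrightarrow> norm z < M"
    using bounded_simple_path_image[OF c(1)] by (metis bounded_pos_less)
  \<comment> \<open>For \<open>v\<close> in \<open>K\<close> of norm at most \<open>e\<close>, the
    point \<open>f v\<close> has norm at least \<open>max R M\<close>: beyond \<open>M\<close> it is
    off the curve, beyond \<open>R\<close> the function is constant. The summand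
    \<open>norm p\<close> pays for the shift by the centre.\<close>
  define e where "e = 1 / (max R M + norm p)"
  have epos: "e > 0" using M norm_ge_zero[of p] unfolding e_def by (simp add: max_def add_pos_nonneg)
  define h where "h v = (if v = 0 then w else g (f v))" for v
  have far: "h v = w" if "v \<in> K" "norm v \<le> e" for v
  proof (cases "v = 0")
    case False
    have "max R M + norm p \<le> inverse (norm v)"
      using that False epos unfolding e_def by (simp add: field_simps)
    also have "\<dots> \<le> norm (f v) + norm p"
      unfolding f_def using norm_triangle_ineq4[of "p + inverse v" p] by (simp add: norm_inverse)
    finally have "R \<le> norm (f v)" "M \<le> norm (f v)" by auto
    moreover from this M that False have "f v \<in> ?O" by (force simp: K_def)
    ultimately show ?thesis using inf False by (simp add: h_def)
  qed (simp add: h_def)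
  have conth: "continuous_on K h"
  proof -
    have "continuous_on (K - ball 0 e) (g \<circ> f)"
    proof (rule continuous_on_compose)
      show "continuous_on (K - ball 0 e) f"
        by (rule continuous_on_subset[OF contf]) (use epos in auto)
      show "continuous_on (f ` (K - ball 0 e)) g"
        by (rule continuous_on_subset[OF g(1)]) (use epos in \<open>auto simp: K_def\<close>)
    qed
    then have "continuous_on (K - ball 0 e) h"
      by (rule continuous_on_eq) (use epos in \<open>auto simp: h_def\<close>)
    moreover have "continuous_on (K \<inter> cball 0 e) h"
      by (rule continuous_on_eq[of _ "\<lambda>_. w"]) (use far in auto)
    ultimately have "continuous_on ((K - ball 0 e) \<union> (K \<inter> cball 0 e)) h"
      by (intro continuous_on_closed_Un) (use \<open>closed K\<close> in \<open>auto simp: closed_Diff\<close>)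
    moreover have "(K - ball 0 e) \<union> (K \<inter> cball 0 e) = K" by auto
    ultimately show ?thesis by simp
  qed
  have hnz: "h v \<noteq> 0" if "v \<in> K" for v
  proof (cases "v = 0")
    case True
    \<comment> \<open>The outside has points of norm at least \<open>R\<close>, so \<open>w\<close>
      is a value of \<open>g\<close> and therefore nonzero.\<close>
    have "\<not> bounded ?O" using J by blast
    then obtain z where "z \<in> ?O" "norm z \<ge> R" by (metis bounded_iff linear)
    with inf g(2)[of z] have "w \<noteq> 0" by auto
    with True show ?thesis by (simp add: h_def)
  next
    case False
    with that have "f v \<in> ?O \<union> path_image c" by (simp add: K_def)
    with g(2) False show ?thesis by (auto simp: h_def)
  qed
  obtain l where l: "continuous_on K l" "\<And>v. v \<in> K \<Longrightarrow> h v = exp (l v)"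
    using log_on_nonseparating_compact[OF compK conK conth hnz] by blast
  have pn: "p \<notin> path_image c" using p iio by blast
  have inK: "inverse (z - p) \<in> K" if "z \<in> path_image c" for z
    using that ff[of z] by (auto simp: K_def)
  show thesis
  proof (rule that[of "l \<circ> (\<lambda>z. inverse (z - p))"])
    show "continuous_on (path_image c) (l \<circ> (\<lambda>z. inverse (z - p)))"
      by (intro continuous_on_compose continuous_intros continuous_on_subset[OF l(1)])
        (use inK pn in auto)
    show "g z = exp ((l \<circ> (\<lambda>z. inverse (z - p))) z)" if "z \<in> path_image c" for z
    proof -
      have "z \<noteq> p" using that pn by auto
      then have "h (inverse (z - p)) = g z" by (simp add: h_def ff)
      then show ?thesis using l(2)[OF inK[OF that]] by simp
    qed
  qed
qed

text \<open>The lifted loop \<open>l \<circ> c\<close> contracts in the convex plane, and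
  \<open>exp\<close> carries the contraction into the punctured plane.\<close>

lemma winding_number_zero_if_log:
  assumes c: "path c" "pathfinish c = pathstart c"
    and l: "continuous_on (path_image c) l" "\<And>z. z \<in> path_image c \<Longrightarrow> g z = exp (l z)"
  shows "winding_number (g \<circ> c) 0 = 0"
proof -
  have lc: "path (l \<circ> c)" "pathfinish (l \<circ> c) = pathstart (l \<circ> c)"
    using path_continuous_image[OF c(1) l(1)] c(2) by (simp_all add: pathfinish_def pathstart_def)
  have "homotopic_loops UNIV (l \<circ> c) (\<lambda>_. 0)"
    by (rule homotopic_loops_linear) (use lc in \<open>auto simp: path_def pathfinish_def pathstart_def\<close>)
  then have "homotopic_loops (- {0}) (exp \<circ> (l \<circ> c)) (exp \<circ> (\<lambda>_. 0))"
    by (rule homotopic_loops_continuous_image) (auto intro!: continuous_intros)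
  moreover have "(exp \<circ> (\<lambda>_. 0)) = linepath (1::complex) 1"
    by (auto simp: linepath_def fun_eq_iff scaleR_conv_of_real algebra_simps)
  ultimately have h: "homotopic_loops (- {0}) (exp \<circ> (l \<circ> c)) (linepath 1 1)" by simp
  have "homotopic_loops (- {0}) (g \<circ> c) (exp \<circ> (l \<circ> c))"
  proof (rule homotopic_loops_sym, rule homotopic_loops_eq)
    show "path (exp \<circ> (l \<circ> c))" by (rule path_continuous_image[OF lc(1)]) (intro continuous_intros)
    show "path_image (exp \<circ> (l \<circ> c)) \<subseteq> - {0}" by (auto simp: path_image_def)
    show "pathfinish (exp \<circ> (l \<circ> c)) = pathstart (exp \<circ> (l \<circ> c))"
      using lc(2) by (simp add: pathfinish_def pathstart_def)
    show "(exp \<circ> (l \<circ> c)) t = (g \<circ> c) t" if "t \<in> {0..1}" for t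
      using that l(2)[of "c t"] by (auto simp: path_image_def)
  qed
  then have "homotopic_loops (- {0}) (g \<circ> c) (linepath 1 1)" using h homotopic_loops_trans by blast
  then have "winding_number (g \<circ> c) 0 = winding_number (linepath 1 1) 0"
    by (rule winding_number_homotopic_loops)
  then show ?thesis by simp
qed

section \<open>Theta curves in the plane\<close>

lemma loop_of_arcs:
  assumes "arc c1" "arc c2" "pathstart c1 = a" "pathfinish c1 = b" "pathstart c2 = a"
    "pathfinish c2 = b" "path_image c1 \<inter> path_image c2 = {a, b}"
  shows "simple_path (c1 +++ reversepath c2)"
    "pathfinish (c1 +++ reversepath c2) = pathstart (c1 +++ reversepath c2)"
    "path_image (c1 +++ reversepath c2) = path_image c1 \<union> path_image c2"
  using assms by (auto intro!: simple_path_join_loop simp: arc_reversepath path_image_join)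

text \<open>Without its ends the arc is connected and misses the loop, so a single point decides the
  side; winding number \<open>0\<close> excludes the inside, where it is \<open>1\<close> or
  \<open>-1\<close>.\<close>

lemma arc_outside_loop:
  fixes c :: "real \<Rightarrow> complex"
  assumes p: "simple_path p" "pathfinish p = pathstart p"
    and c: "arc c" "path_image c \<inter> path_image p = {pathstart c, pathfinish c}"
    and x: "x \<in> path_image c - {pathstart c, pathfinish c}" "winding_number p x = 0"
  shows "path_image c - {pathstart c, pathfinish c} \<subseteq> outside (path_image p)"
proof -
  let ?C = "path_image c - {pathstart c, pathfinish c}"
  note J = Jordan_inside_outside[OF p]
  have "x \<notin> inside (path_image p)"
    using simple_closed_path_winding_number_inside[OF p(1)] x(2) p(2)
    by (metis one_neq_zero neg_0_equal_iff_equal)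
  then have xo: "x \<in> outside (path_image p)" using x(1) c(2) unfolding outside_inside by blast
  have "connected ?C" using c(1) arc_imp_simple_path connected_simple_path_endless by blast
  moreover have "?C \<inter> frontier (outside (path_image p)) = {}" using J c(2) by auto
  ultimately show ?thesis using connected_Int_frontier[of ?C "outside (path_image p)"] x(1) xo by blast
qed

text \<open>If the insides met, each would contain the other, being connected and disjoint from the
  other's frontier. Equal insides have equal frontiers, that is, equal curves.\<close>

lemma inside_disjoint:
  fixes p q :: "real \<Rightarrow> complex"
  assumes p: "simple_path p" "pathfinish p = pathstart p"
    and q: "simple_path q" "pathfinish q = pathstart q"
    and d: "inside (path_image p) \<inter> path_image q = {}" "inside (path_image q) \<inter> path_image p = {}"
      "path_image p \<noteq> path_image q"
  shows "inside (path_image p) \<inter> inside (path_image q) = {}"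
proof (rule ccontr)
  assume ne: "\<not> ?thesis"
  note Jp = Jordan_inside_outside[OF p] and Jq = Jordan_inside_outside[OF q]
  have "inside (path_image p) \<subseteq> inside (path_image q)"
    using connected_Int_frontier[of "inside (path_image p)" "inside (path_image q)"] ne d
    by (metis Diff_eq_empty_iff Jp Jq)
  moreover have "inside (path_image q) \<subseteq> inside (path_image p)"
    using connected_Int_frontier[of "inside (path_image q)" "inside (path_image p)"] ne d
    by (metis Diff_eq_empty_iff Int_commute Jp Jq)
  ultimately have "inside (path_image p) = inside (path_image q)" by blast
  then show False using Jp Jq d(3) by metis
qed

text \<open>The three loops of a theta curve satisfy a linear relation between their winding numbers, so
  they cannot have pairwise disjoint insides.\<close>

lemma theta_curve_not_all_arcs_outside:
  fixes c1 c2 c3 :: "real \<Rightarrow> complex"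
  assumes arcs: "arc c1" "arc c2" "arc c3"
    and ends: "pathstart c1 = a" "pathfinish c1 = b" "pathstart c2 = a" "pathfinish c2 = b"
      "pathstart c3 = a" "pathfinish c3 = b"
    and int: "path_image c1 \<inter> path_image c2 = {a, b}" "path_image c2 \<inter> path_image c3 = {a, b}"
      "path_image c1 \<inter> path_image c3 = {a, b}"
    and x1: "x1 \<in> path_image c1 - {a, b}" "winding_number (c2 +++ reversepath c3) x1 = 0"
    and x2: "x2 \<in> path_image c2 - {a, b}" "winding_number (c1 +++ reversepath c3) x2 = 0"
    and x3: "x3 \<in> path_image c3 - {a, b}" "winding_number (c1 +++ reversepath c2) x3 = 0"
  shows False
proof -
  let ?p12 = "c1 +++ reversepath c2" and ?p13 = "c1 +++ reversepath c3"
    and ?p23 = "c2 +++ reversepath c3"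
  note l12 = loop_of_arcs[OF arcs(1,2) ends(1-4) int(1)]
  note l13 = loop_of_arcs[OF arcs(1,3) ends(1,2,5,6) int(3)]
  note l23 = loop_of_arcs[OF arcs(2,3) ends(3-6) int(2)]
  have ab: "a \<in> path_image c1" "b \<in> path_image c1" "a \<in> path_image c2" "b \<in> path_image c2"
     "a \<in> path_image c3" "b \<in> path_image c3" using int by auto
  have o3: "path_image c3 - {a, b} \<subseteq> outside (path_image ?p12)"
    using arc_outside_loop[OF l12(1,2) arcs(3) _ _ x3(2)] x3(1) int ab ends by (force simp: l12(3))
  have o2: "path_image c2 - {a, b} \<subseteq> outside (path_image ?p13)"
    using arc_outside_loop[OF l13(1,2) arcs(2) _ _ x2(2)] x2(1) int ab ends by (force simp: l13(3))
  have o1: "path_image c1 - {a, b} \<subseteq> outside (path_image ?p23)"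
    using arc_outside_loop[OF l23(1,2) arcs(1) _ _ x1(2)] x1(1) int ab ends by (force simp: l23(3))
  have d': "inside (path_image ?p12) \<inter> (path_image c1 \<union> path_image c2) = {}"
    "inside (path_image ?p13) \<inter> (path_image c1 \<union> path_image c3) = {}"
    "inside (path_image ?p23) \<inter> (path_image c2 \<union> path_image c3) = {}"
    using inside_no_overlap[of "path_image ?p12"] inside_no_overlap[of "path_image ?p13"]
      inside_no_overlap[of "path_image ?p23"] by (simp_all only: l12(3) l13(3) l23(3))
  have "inside (path_image ?p12) \<inter> path_image c3 = {}"
    using o3 d'(1) ab unfolding outside_inside by blast
  moreover have "inside (path_image ?p13) \<inter> path_image c2 = {}"
    using o2 d'(2) ab unfolding outside_inside by blast
  moreover have "inside (path_image ?p23) \<inter> path_image c1 = {}"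
    using o1 d'(3) ab unfolding outside_inside by blast
  ultimately have d: "inside (path_image ?p12) \<inter> path_image c3 = {}"
    "inside (path_image ?p13) \<inter> path_image c2 = {}" "inside (path_image ?p23) \<inter> path_image c1 = {}"
    by blast+
  have n: "path_image ?p12 \<noteq> path_image ?p13" "path_image ?p12 \<noteq> path_image ?p23"
    using x1(1) x2(1) int unfolding l12(3) l13(3) l23(3) by blast+
  have "inside (path_image ?p12) \<inter> inside (path_image ?p13) = {}"
    by (rule inside_disjoint[OF l12(1,2) l13(1,2) _ _ n(1)])
      (use d(1,2) d'(1,2) in \<open>simp_all only: l12(3) l13(3), blast+\<close>)
  moreover have "inside (path_image ?p12) \<inter> inside (path_image ?p23) = {}"
    by (rule inside_disjoint[OF l12(1,2) l23(1,2) _ _ n(2)])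
      (use d(1,3) d'(1,3) in \<open>simp_all only: l12(3) l23(3), blast+\<close>)
  moreover obtain z where z: "z \<in> inside (path_image ?p12)"
    using Jordan_inside_outside[OF l12(1,2)] by blast
  moreover have zn: "z \<notin> path_image c1" "z \<notin> path_image c2" "z \<notin> path_image c3"
    using z d(1) d'(1) by blast+
  ultimately have zo: "z \<in> outside (path_image ?p13)" "z \<in> outside (path_image ?p23)"
    unfolding outside_inside l13(3) l23(3) by blast+
  have paths: "path c1" "path c2" "path c3" using arcs arc_imp_path by auto
  have w: "winding_number (p +++ reversepath q) z = winding_number p z - winding_number q z"
    if "path p" "path q" "z \<notin> path_image p" "z \<notin> path_image q" "pathfinish p = pathfinish q" for p q
    using that by (simp add: winding_number_join winding_number_reversepath)
  have "winding_number ?p13 z = 0"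
    using winding_number_zero_in_outside zo(1) l13 simple_path_imp_path by blast
  moreover have "winding_number ?p23 z = 0"
    using winding_number_zero_in_outside zo(2) l23 simple_path_imp_path by blast
  \<comment> \<open>The linear relation: with \<open>n\<close> for the winding number around
    \<open>z\<close>, \<open>n c1 - n c2 = (n c1 - n c3) - (n c2 - n c3)\<close>, and both terms on
    the right vanish.\<close>
  ultimately have "winding_number ?p12 z = 0" using paths zn ends by (simp add: w)
  then show False
    using simple_closed_path_winding_number_inside[OF l12(1)] l12(2) z
    by (metis one_neq_zero neg_0_equal_iff_equal)
qed

section \<open>The drawing given by three coordinates\<close>

text \<open>Subtracting the third coordinate is a linear map onto the plane whose kernel is spanned
  by \<open>(1, 1, 1)\<close>.\<close>

definition proj3 :: "(3 \<Rightarrow> real) \<Rightarrow> complex" where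
  "proj3 p = Complex (p 1 - p 3) (p 2 - p 3)"

lemma proj3_eq_iff: "proj3 p = proj3 q \<longleftrightarrow> (\<exists>t. \<forall>s. p s = q s + t)"
proof
  assume "proj3 p = proj3 q"
  then have "\<forall>s. p s = q s + (p 3 - q 3)" by (simp add: proj3_def forall_3)
  then show "\<exists>t. \<forall>s. p s = q s + t" by blast
qed (auto simp: proj3_def)

text \<open>A straight segment from the point of \<open>u\<close> at \<open>r = 0\<close> to the
  bend at \<open>r = 1\<close>, the join of both ends. It never decreases in any coordinate, and it
  is constant where \<open>v\<close> is below \<open>u\<close>.\<close>

definition half_edge :: "(3 \<Rightarrow> 'v \<Rightarrow> real) \<Rightarrow> 'v \<Rightarrow> 'v \<Rightarrow> real \<Rightarrow> 3 \<Rightarrow> real" where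
  "half_edge X u v r s = X s u + r * max (X s v - X s u) 0"

lemma half_edge_0: "half_edge X u v 0 = (\<lambda>s. X s u)"
  by (simp add: half_edge_def fun_eq_iff)

lemma half_edge_1: "half_edge X u v 1 = half_edge X v u 1"
  by (auto simp: half_edge_def fun_eq_iff max_def)

lemma half_edge_ge: "0 \<le> r \<Longrightarrow> X s u \<le> half_edge X u v r s"
  by (simp add: half_edge_def)

lemma half_edge_le: "0 \<le> r \<Longrightarrow> r \<le> 1 \<Longrightarrow> half_edge X u v r s \<le> max (X s u) (X s v)"
proof -
  assume "0 \<le> r" "r \<le> 1"
  then have "r * max (X s v - X s u) 0 \<le> 1 * max (X s v - X s u) 0"
    by (intro mult_right_mono) auto
  then show ?thesis by (auto simp: half_edge_def)
qed

definition half_curve :: "(3 \<Rightarrow> 'v \<Rightarrow> real) \<Rightarrow> 'v \<Rightarrow> 'v \<Rightarrow> real \<Rightarrow> complex" where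
  "half_curve X u v r = proj3 (half_edge X u v r)"

lemma path_half_curve: "path (half_curve X u v)"
  unfolding path_def half_curve_def proj3_def half_edge_def
  by (intro continuous_intros continuous_on_Complex)

text \<open>Edges become elbow geodesics of the orthogonal surface generated by the vertex points.
  For an edge with two ends, the choice by \<open>SOME\<close> affects only the direction of
  traversal.\<close>

definition orthogonal_drawing ::
    "('v, 'e) multigraph \<Rightarrow> (3 \<Rightarrow> 'v \<Rightarrow> real) \<Rightarrow> ('v, 'e) drawing" where
  "orthogonal_drawing H X =
     \<lparr>point = (\<lambda>v. proj3 (\<lambda>s. X s v)),
      curve = (\<lambda>e. let (u, v) = (SOME p. ends H e = {fst p, snd p}) in
                     half_curve X u v +++ reversepath (half_curve X v u))\<rparr>"

text \<open>The last two assumptions say that the vertex points form an antichain and that the bend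
  of an edge dominates no vertex other than its ends.\<close>

locale order_coordinates = finite_multigraph H for H :: "('v, 'e) multigraph" (structure) +
  fixes X :: "3 \<Rightarrow> 'v \<Rightarrow> real"
  assumes loopless: "e \<in> edges H \<Longrightarrow> card (ends H e) = 2"
    and no_parallel: "e \<in> edges H \<Longrightarrow> e' \<in> edges H \<Longrightarrow> ends H e = ends H e' \<Longrightarrow> e = e'"
    and vertex_above_vertex: "v \<in> verts H \<Longrightarrow> w \<in> verts H \<Longrightarrow> v \<noteq> w \<Longrightarrow> \<exists>s. X s w < X s v"
    and vertex_above_edge:
      "e \<in> edges H \<Longrightarrow> ends H e = {u, v} \<Longrightarrow> w \<in> verts H \<Longrightarrow> w \<notin> {u, v} \<Longrightarrow>
         \<exists>s. max (X s u) (X s v) < X s w"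
begin

lemma ends_cases:
  assumes "e \<in> edges H" "ends H e = {u, v}"
  shows "u \<in> verts H" "v \<in> verts H" "u \<noteq> v"
  using assms ends_subset[OF assms(1)] loopless[OF assms(1)] by (auto simp: card_2_iff)

text \<open>Points of a half edge lie below the bend, so whatever they dominate is dominated by the
  bend.\<close>

lemma dominated_vertex:
  assumes e: "e \<in> edges H" "ends H e = {u, v}" and r: "0 \<le> r" "r \<le> 1" and w: "w \<in> verts H"
    and le: "\<And>s. X s w \<le> half_edge X u v r s"
  shows "w \<in> {u, v}"
  using vertex_above_edge[OF e w] le half_edge_le[OF r] by (meson le_less_trans not_le order_trans)

text \<open>Equal projections differ by \<open>t\<close> along the diagonal. A negative
  \<open>t\<close> puts \<open>u\<close> below \<open>w\<close>, a nonnegative one makes the half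
  edge dominate \<open>w\<close>, so \<open>w\<close> is an end of the edge. A coordinate in which
  the half edge rises (\<open>s1\<close>) and one in which it rests at \<open>u\<close>
  (\<open>s2\<close>) then exclude \<open>v\<close> and fix \<open>t\<close> and
  \<open>r\<close>.\<close>

lemma half_edge_meets_vertex:
  assumes e: "e \<in> edges H" "ends H e = {u, v}" and r: "0 \<le> r" "r \<le> 1" and w: "w \<in> verts H"
    and eq: "proj3 (half_edge X u v r) = proj3 (\<lambda>s. X s w)"
  shows "w = u \<and> r = 0"
proof -
  note V = ends_cases[OF e]
  obtain s1 where s1: "X s1 u < X s1 v" using vertex_above_vertex V by metis
  obtain s2 where s2: "X s2 v < X s2 u" using vertex_above_vertex V by metis
  obtain t where t: "\<And>s. half_edge X u v r s = X s w + t"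
    using eq unfolding proj3_eq_iff by blast
  have h2: "half_edge X u v r s2 = X s2 u" using s2 by (simp add: half_edge_def)
  have "t < 0 \<Longrightarrow> w = u"
  proof (rule ccontr)
    assume "t < 0" "w \<noteq> u"
    then obtain s where "X s w < X s u" using vertex_above_vertex[of u w] w V by blast
    then show False using t[of s] half_edge_ge[OF r(1), of X s u v] \<open>t < 0\<close> by linarith
  qed
  moreover have "w \<in> {u, v}" if "t \<ge> 0"
    using dominated_vertex[OF e r w] t that by simp
  moreover have "w \<noteq> v"
  proof
    assume [simp]: "w = v"
    have "half_edge X u v r s1 \<le> X s1 v" using half_edge_le[OF r, of X u v s1] s1 by simp
    then have "t \<le> 0" using t[of s1] by simp
    then show False using t[of s2] h2 s2 by simp
  qed
  ultimately have wu: "w = u" by fastforce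
  then have "t = 0" using t[of s2] h2 by simp
  with t[of s1] wu s1 have "r = 0" by (simp add: half_edge_def)
  with wu show ?thesis by simp
qed

text \<open>The positive part of \<open>v' - u\<close> would be \<open>r / r'\<close> times that of
  \<open>v - u\<close>. Since this ratio is at most \<open>1\<close>, \<open>v'\<close> would be
  dominated by the bend of \<open>u\<close> and \<open>v\<close>.\<close>

lemma common_start_collision:
  assumes e: "e \<in> edges H" "ends H e = {u, v}" and e': "e' \<in> edges H" "ends H e' = {u, v'}"
    and ne: "v \<noteq> v'" and r: "0 \<le> r" "0 < r'" "r \<le> r'"
    and eq: "\<And>s. r * max (X s v - X s u) 0 = r' * max (X s v' - X s u) 0"
  shows False
proof -
  note V = ends_cases[OF e] ends_cases[OF e']
  have "max (X s v' - X s u) 0 \<le> max (X s v - X s u) 0" for s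
  proof -
    have "r' * max (X s v' - X s u) 0 \<le> r' * max (X s v - X s u) 0"
      using eq[of s] r by (metis max.cobounded2 mult_right_mono)
    then show ?thesis using r by simp
  qed
  then have "X s v' \<le> max (X s u) (X s v)" for s
    by (smt (verit) max_def)
  moreover obtain s where "max (X s u) (X s v) < X s v'"
    using vertex_above_edge[OF e, of v'] V ne by auto
  ultimately show False by (meson not_le)
qed

text \<open>The sign of the diagonal shift \<open>t\<close> tells which start vertex is dominated:
  \<open>u'\<close> is an end of \<open>e\<close> if \<open>t\<close> is nonnegative,
  \<open>u\<close> an end of \<open>e'\<close> if \<open>t\<close> is nonpositive. What survives is
  a common start or the two halves of one edge; every other combination contradicts the sign in a
  coordinate where a half edge rises.\<close>

lemma half_edge_collision:
  assumes e: "e \<in> edges H" "ends H e = {u, v}" and e': "e' \<in> edges H" "ends H e' = {u', v'}"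
    and r: "0 \<le> r" "r \<le> 1" and r': "0 \<le> r'" "r' \<le> 1"
    and eq: "proj3 (half_edge X u v r) = proj3 (half_edge X u' v' r')"
  shows "(u = u' \<and> v = v' \<and> r = r') \<or> (u = u' \<and> r = 0 \<and> r' = 0) \<or> (u' = v \<and> v' = u \<and> r = 1 \<and> r' = 1)"
proof -
  note V = ends_cases[OF e] and V' = ends_cases[OF e']
  obtain t where t: "\<And>s. half_edge X u v r s = half_edge X u' v' r' s + t"
    using eq unfolding proj3_eq_iff by blast
  have dom: "t \<ge> 0 \<Longrightarrow> u' \<in> {u, v}"
    by (rule dominated_vertex[OF e r V'(1)]) (use half_edge_ge[OF r'(1), of X _ u' v'] t in \<open>smt (verit)\<close>)
  have dom': "t \<le> 0 \<Longrightarrow> u \<in> {u', v'}"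
    by (rule dominated_vertex[OF e' r' V(1)]) (use half_edge_ge[OF r(1), of X _ u v] t in \<open>smt (verit)\<close>)
  obtain s1 where s1: "X s1 u < X s1 v" using vertex_above_vertex V by metis
  obtain s2 where s2: "X s2 v < X s2 u" using vertex_above_vertex V by metis
  obtain s1' where s1': "X s1' u' < X s1' v'" using vertex_above_vertex V' by metis
  obtain s2' where s2': "X s2' v' < X s2' u'" using vertex_above_vertex V' by metis
  have h2: "half_edge X u v r s2 = X s2 u" using s2 by (simp add: half_edge_def)
  have h2': "half_edge X u' v' r' s2' = X s2' u'" using s2' by (simp add: half_edge_def)
  have h1: "half_edge X u v r s1 \<le> X s1 v" using half_edge_le[OF r, of X u v s1] s1 by simp
  have h1': "half_edge X u' v' r' s1' \<le> X s1' v'" using half_edge_le[OF r', of X u' v' s1'] s1' by simp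
  consider "u = u'" | "u \<noteq> u'" "u' = v" "v' = u" | "u \<noteq> u'" "u' = v" "v' \<noteq> u"
    | "u \<noteq> u'" "u' \<noteq> v" by blast
  then show ?thesis
  proof cases
    case 1
    have "t \<le> 0" using t[of s2] h2 half_edge_ge[OF r'(1), of X s2 u' v'] 1 by simp
    moreover have "t \<ge> 0" using t[of s2'] h2' half_edge_ge[OF r(1), of X s2' u v] 1 by simp
    ultimately have eqs: "r * max (X s v - X s u) 0 = r' * max (X s v' - X s u) 0" for s
      using t[of s] 1 by (simp add: half_edge_def)
    have z: "r = 0 \<longleftrightarrow> r' = 0"
      using eqs[of s1] eqs[of s1'] s1 s1' 1 by auto
    show ?thesis
    proof (cases "v = v'")
      case True
      then have "r = r'" using eqs[of s1] s1 by simp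
      with 1 True show ?thesis by simp
    next
      case False
      have "r' \<le> 0 \<or> r \<le> 0"
        using common_start_collision[OF e e'(1) _ False r(1), of r']
          common_start_collision[OF e' e(1), of v r' r] False e' e eqs 1 r'
        by (metis linear not_le)
      with z r r' 1 show ?thesis by auto
    qed
  next
    case 2
    have "t \<le> 0" using t[of s1] half_edge_ge[OF r'(1), of X s1 u' v'] h1 2 by simp
    moreover have "t \<ge> 0" using t[of s1'] half_edge_ge[OF r(1), of X s1' u v] h1' 2 by simp
    ultimately have t0: "t = 0" by simp
    have "X s1 u + r * (X s1 v - X s1 u) = X s1 v"
      using t[of s1] s1 2 t0 by (simp add: half_edge_def)
    then have "(1 - r) * (X s1 v - X s1 u) = 0" by (simp add: algebra_simps)
    then have "r = 1" using s1 by simp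
    have "X s2 u = X s2 v + r' * (X s2 u - X s2 v)"
      using t[of s2] s2 2 t0 by (simp add: half_edge_def)
    then have "(1 - r') * (X s2 u - X s2 v) = 0" by (simp add: algebra_simps)
    then have "r' = 1" using s2 by simp
    with \<open>r = 1\<close> 2 show ?thesis by simp
  next
    case 3
    then have "t > 0" using dom' by fastforce
    with t[of s1] half_edge_ge[OF r'(1), of X s1 u' v'] h1 3 show ?thesis by simp
  next
    case 4
    then have "t < 0" using dom by fastforce
    then have "u = v'" using dom' 4 by simp
    with t[of s1'] half_edge_ge[OF r(1), of X s1' u v] h1' \<open>t < 0\<close> show ?thesis by simp
  qed
qed

abbreviation D' where "D' \<equiv> orthogonal_drawing H X"

lemma curve_orthogonal:
  assumes "e \<in> edges H"
  obtains u v where "ends H e = {u, v}"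
    "curve D' e = half_curve X u v +++ reversepath (half_curve X v u)"
proof -
  define p where "p = (SOME p. ends H e = {fst p, snd p})"
  obtain a b where "ends H e = {a, b}" using loopless[OF assms] card_2_iff by metis
  then have "ends H e = {fst (a, b), snd (a, b)}" by simp
  then have "ends H e = {fst p, snd p}" unfolding p_def by (rule someI)
  then show thesis
    by (rule that) (simp add: orthogonal_drawing_def p_def[symmetric] case_prod_unfold)
qed

text \<open>Treats both halves of an edge alike. Positivity of \<open>r\<close> at inner parameters
  is what rules out collisions at a common start vertex.\<close>

lemma curve_orthogonal_point:
  assumes e: "e \<in> edges H" and t: "0 \<le> t" "t \<le> 1"
  obtains u v r where "ends H e = {u, v}" "0 \<le> r" "r \<le> 1" "0 < t \<Longrightarrow> t < 1 \<Longrightarrow> 0 < r"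
    "curve D' e t = proj3 (half_edge X u v r)"
proof -
  obtain u v where uv: "ends H e = {u, v}"
    "curve D' e = half_curve X u v +++ reversepath (half_curve X v u)"
    using curve_orthogonal[OF e] .
  show thesis
  proof (cases "t \<le> 1/2")
    case True
    show ?thesis by (rule that[OF uv(1), of "2 * t"]) (use True t in \<open>auto simp: uv(2) joinpaths_def half_curve_def\<close>)
  next
    case False
    show ?thesis
      by (rule that[of v u "2 - 2 * t"])
        (use False t uv(1) in \<open>auto simp: uv(2) joinpaths_def reversepath_def half_curve_def algebra_simps\<close>)
  qed
qed

lemma arc_half_curve:
  assumes "e \<in> edges H" "ends H e = {u, v}"
  shows "arc (half_curve X u v)"
  unfolding arc_def
proof
  show "inj_on (half_curve X u v) {0..1}"
    using half_edge_collision[OF assms assms] by (intro inj_onI) (auto simp: half_curve_def)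
qed (rule path_half_curve)

lemma planar_map_orthogonal_drawing: "planar_map H D'"
proof unfold_locales
  have point: "point D' v = proj3 (\<lambda>s. X s v)" for v by (simp add: orthogonal_drawing_def)
  show "inj_on (point D') (verts H)"
  proof (rule inj_onI, rule ccontr)
    fix v w assume vw: "v \<in> verts H" "w \<in> verts H" "point D' v = point D' w" "v \<noteq> w"
    then obtain t where t: "\<And>s. X s v = X s w + t" unfolding point proj3_eq_iff by blast
    obtain s where "X s w < X s v" using vertex_above_vertex vw by blast
    moreover obtain s' where "X s' v < X s' w" using vertex_above_vertex[of w v] vw by blast
    ultimately show False using t[of s] t[of s'] by simp
  qed
  fix e assume e: "e \<in> edges H"
  obtain u v where uv: "ends H e = {u, v}"
    and cu: "curve D' e = half_curve X u v +++ reversepath (half_curve X v u)"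
    using curve_orthogonal[OF e] .
  have vu: "ends H e = {v, u}" using uv by blast
  have mid: "half_curve X u v 1 = half_curve X v u 1" by (simp add: half_curve_def half_edge_1[of X u])
  have "arc (curve D' e)" unfolding cu
  proof (rule arc_join)
    show "arc (half_curve X u v)" using arc_half_curve[OF e uv] .
    show "arc (reversepath (half_curve X v u))" using arc_half_curve[OF e vu] by (rule arc_reversepath)
    show "pathfinish (half_curve X u v) = pathstart (reversepath (half_curve X v u))"
      using mid by (simp add: pathfinish_def)
    show "path_image (half_curve X u v) \<inter> path_image (reversepath (half_curve X v u))
        \<subseteq> {pathstart (reversepath (half_curve X v u))}"
    proof
      fix z assume "z \<in> path_image (half_curve X u v) \<inter> path_image (reversepath (half_curve X v u))"
      then obtain r r' where r: "0 \<le> r" "r \<le> 1" "0 \<le> r'" "r' \<le> 1"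
        "z = proj3 (half_edge X u v r)" "z = proj3 (half_edge X v u r')"
        by (auto simp: path_image_def[of "half_curve X _ _"] half_curve_def)
      \<comment> \<open>The start vertices differ, so only the alternative of a common bend is
        left.\<close>
      then have "r' = 1" using half_edge_collision[OF e uv e vu, of r r'] ends_cases[OF e uv] by auto
      then show "z \<in> {pathstart (reversepath (half_curve X v u))}"
        using r by (simp add: pathfinish_def half_curve_def)
    qed
  qed
  then show "simple_path (curve D' e)" by (rule arc_imp_simple_path)
  show "{pathstart (curve D' e), pathfinish (curve D' e)} = point D' ` ends H e"
    unfolding cu uv by (simp add: point) (simp add: pathstart_def half_curve_def half_edge_0)
  show "curve D' e ` {0<..<1} \<inter> point D' ` verts H = {}"
  proof (rule ccontr)
    assume "curve D' e ` {0<..<1} \<inter> point D' ` verts H \<noteq> {}"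
    then obtain t w where t: "0 < t" "t < 1" and w: "w \<in> verts H" "curve D' e t = point D' w" by auto
    obtain a b r where ab: "ends H e = {a, b}" and r: "0 \<le> r" "r \<le> 1" "0 < r"
      and c: "curve D' e t = proj3 (half_edge X a b r)"
      using curve_orthogonal_point[OF e, of t] t by (metis less_imp_le)
    show False using half_edge_meets_vertex[OF e ab r(1,2) w(1)] w(2) c r(3) by (simp add: point)
  qed
  fix e' assume e': "e' \<in> edges H" and ne: "e \<noteq> e'"
  show "curve D' e ` {0<..<1} \<inter> curve D' e' ` {0<..<1} = {}"
  proof (rule ccontr)
    assume "curve D' e ` {0<..<1} \<inter> curve D' e' ` {0<..<1} \<noteq> {}"
    then obtain t t' where t: "0 < t" "t < 1" "0 < t'" "t' < 1" and eq: "curve D' e t = curve D' e' t'"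
      by auto
    obtain a b r where ab: "ends H e = {a, b}" and r: "0 \<le> r" "r \<le> 1" "0 < r"
      and c: "curve D' e t = proj3 (half_edge X a b r)"
      using curve_orthogonal_point[OF e, of t] t by (metis less_imp_le)
    obtain a' b' r' where ab': "ends H e' = {a', b'}" and r': "0 \<le> r'" "r' \<le> 1" "0 < r'"
      and c': "curve D' e' t' = proj3 (half_edge X a' b' r')"
      using curve_orthogonal_point[OF e', of t'] t by (metis less_imp_le)
    \<comment> \<open>Positive parameters leave only the same half edge or two halves with the same
      ends.\<close>
    have "{a, b} = {a', b'}"
      using half_edge_collision[OF e ab e' ab' r(1,2) r'(1,2)] c c' eq r(3) r'(3) by auto
    then show False using no_parallel[OF e e'] ab ab' ne by simp
  qed
qed

end

section \<open>Paths and incidences in planar maps\<close>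

definition oriented_curve :: "('v, 'e) drawing \<Rightarrow> 'v \<Rightarrow> 'e \<Rightarrow> real \<Rightarrow> complex" where
  "oriented_curve D u e =
     (if pathstart (curve D e) = point D u then curve D e else reversepath (curve D e))"

fun path_curve :: "('v, 'e) drawing \<Rightarrow> 'v list \<Rightarrow> 'e list \<Rightarrow> real \<Rightarrow> complex" where
  "path_curve D (u # xs) (e # es) =
     (if es = [] then oriented_curve D u e else oriented_curve D u e +++ path_curve D xs es)"
| "path_curve D _ _ = undefined"

lemma path_image_oriented_curve [simp]: "path_image (oriented_curve D u e) = path_image (curve D e)"
  by (simp add: oriented_curve_def)

text \<open>The breakpoints of the joined path depend on the lists only and not on the drawing. This
  synchronizes a cycle in the two drawings, as the homotopy between them requires.\<close>

lemma path_curve_same_edge: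
  assumes "length xs = Suc (length es)" "es \<noteq> []" "t \<in> {0..1}"
  shows "\<exists>e\<in>set es. path_curve D xs es t \<in> path_image (curve D e) \<and>
    path_curve D' xs es t \<in> path_image (curve D' e)"
  using assms
proof (induction es arbitrary: xs t)
  case (Cons e es)
  then obtain u ys where xs: "xs = u # ys" "length ys = Suc (length es)" by (cases xs) auto
  have or: "oriented_curve D u e r \<in> path_image (curve D e)" if "r \<in> {0..1}" for r and D :: "('a, 'b) drawing"
    using that path_image_oriented_curve[of D u e] by (metis imageI path_image_def)
  show ?case
  proof (cases "es = []")
    case True
    then show ?thesis using xs or Cons.prems by simp
  next
    case False
    show ?thesis
    proof (cases "t \<le> 1/2")
      case True
      then have "2 * t \<in> {0..1}" using Cons.prems by simp
      then show ?thesis using True False xs or[of "2 * t"] by (simp add: joinpaths_def)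
    next
      case False2: False
      have "\<exists>f\<in>set es. path_curve D ys es (2 * t - 1) \<in> path_image (curve D f) \<and>
        path_curve D' ys es (2 * t - 1) \<in> path_image (curve D' f)"
        by (rule Cons.IH) (use False False2 Cons.prems xs in \<open>auto simp: neq_Nil_conv\<close>)
      then show ?thesis using False False2 xs by (auto simp: joinpaths_def)
    qed
  qed
qed simp

lemma graph_path_Cons:
  assumes "graph_path G (u # v # xs) (e # es)"
  shows "graph_path G (v # xs) es" "ends G e = {u, v}" "e \<in> edges G" "u \<notin> set (v # xs)"
    "u \<in> verts G" "v \<in> verts G"
proof -
  have all: "ends G ((e # es) ! i) = {(u # v # xs) ! i, (u # v # xs) ! Suc i}"
    if "i < length (e # es)" for i
    using assms that unfolding graph_path_def by blast
  have "ends G (es ! i) = {(v # xs) ! i, (v # xs) ! Suc i}" if "i < length es" for i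
    using all[of "Suc i"] that by simp
  then show "graph_path G (v # xs) es" using assms unfolding graph_path_def by auto
  show "ends G e = {u, v}" using all[of 0] by simp
qed (use assms in \<open>auto simp: graph_path_def\<close>)

lemma graph_path_ends_subset:
  assumes "graph_path G xs es" "e \<in> set es"
  shows "ends G e \<subseteq> set xs"
proof -
  obtain i where "i < length es" "e = es ! i" using assms(2) by (metis in_set_conv_nth)
  then show ?thesis using assms(1) unfolding graph_path_def by auto
qed

context planar_map
begin

lemma path_image_curve:
  assumes "e \<in> edges G"
  shows "path_image (curve D e) = curve D e ` {0<..<1} \<union> point D ` ends G e"
proof -
  have "{0..1::real} = {0<..<1} \<union> {0, 1}" by auto
  then have "path_image (curve D e) = curve D e ` {0<..<1} \<union> {pathstart (curve D e), pathfinish (curve D e)}"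
    unfolding path_image_def pathstart_def pathfinish_def by (metis image_Un image_empty image_insert)
  then show ?thesis using curve_ends[OF assms] by simp
qed

lemma inner_curve_Int:
  assumes "e \<in> edges G" "e' \<in> edges G" "e \<noteq> e'"
  shows "curve D e ` {0<..<1} \<inter> path_image (curve D e') = {}"
  using curves_disjoint[OF assms] curve_avoids_verts[OF assms(1)] ends_subset[OF assms(2)]
  unfolding path_image_curve[OF assms(2)] by blast

lemma path_image_curve_Int:
  assumes "e \<in> edges G" "e' \<in> edges G" "e \<noteq> e'"
  shows "path_image (curve D e) \<inter> path_image (curve D e') \<subseteq> point D ` (ends G e \<inter> ends G e')"
proof
  fix z assume z: "z \<in> path_image (curve D e) \<inter> path_image (curve D e')"
  have "z \<notin> curve D e ` {0<..<1}"
    using z inner_curve_Int[OF assms] by (meson IntE disjoint_iff)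
  moreover have "z \<notin> curve D e' ` {0<..<1}"
    using z inner_curve_Int[OF assms(2,1) assms(3)[symmetric]] by (meson IntE disjoint_iff)
  ultimately have "z \<in> point D ` ends G e" "z \<in> point D ` ends G e'"
    using z path_image_curve[OF assms(1)] path_image_curve[OF assms(2)] by (metis IntE UnE)+
  moreover have "inj_on (point D) (ends G e \<union> ends G e')"
    using inj_point inj_on_subset ends_subset assms by (metis Un_least)
  ultimately show "z \<in> point D ` (ends G e \<inter> ends G e')"
    using inj_on_image_Int[of "point D" _ "ends G e" "ends G e'"] by (metis IntI Un_upper1 Un_upper2)
qed

lemma oriented_curve:
  assumes e: "e \<in> edges G" "ends G e = {u, v}" "u \<noteq> v"
  shows "arc (oriented_curve D u e)" "pathstart (oriented_curve D u e) = point D u"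
    "pathfinish (oriented_curve D u e) = point D v"
proof -
  have ne: "point D u \<noteq> point D v"
    using inj_point ends_subset[OF e(1)] e(2,3) by (auto simp: inj_on_def)
  have eq: "{pathstart (curve D e), pathfinish (curve D e)} = {point D u, point D v}"
    using curve_ends[OF e(1)] e(2) by simp
  with ne have "pathfinish (curve D e) \<noteq> pathstart (curve D e)" by (auto simp: doubleton_eq_iff)
  then have "arc (curve D e)" using simple_curve[OF e(1)] simple_path_imp_arc by metis
  then show "arc (oriented_curve D u e)" by (simp add: oriented_curve_def arc_reversepath)
  show "pathstart (oriented_curve D u e) = point D u" "pathfinish (oriented_curve D u e) = point D v"
    using eq ne by (auto simp: oriented_curve_def doubleton_eq_iff)
qed

lemma path_curve:
  assumes "graph_path G xs es" "es \<noteq> []"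
  shows "arc (path_curve D xs es) \<and> pathstart (path_curve D xs es) = point D (hd xs) \<and>
    pathfinish (path_curve D xs es) = point D (last xs) \<and>
    path_image (path_curve D xs es) = (\<Union>e\<in>set es. path_image (curve D e))"
  using assms
proof (induction es arbitrary: xs)
  case (Cons e es)
  then have "length xs = Suc (Suc (length es))" by (simp add: graph_path_def)
  then obtain u v ys where xs: "xs = u # v # ys" by (metis length_Suc_conv)
  note P = graph_path_Cons[OF Cons.prems(1)[unfolded xs]]
  have uv: "u \<noteq> v" using P(4) by auto
  note o = oriented_curve[OF P(3,2) uv]
  show ?case
  proof (cases "es = []")
    case True
    then have "ys = []" using P(1) by (simp add: graph_path_def)
    then show ?thesis using True o xs by simp
  next
    case False
    note IH = Cons.IH[OF P(1) False]
    \<comment> \<open>Later edges have their ends on the rest of the path, which avoids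
      \<open>u\<close>; only \<open>v\<close> can be shared.\<close>
    have pi: "path_image (curve D e) \<inter> path_image (path_curve D (v # ys) es) \<subseteq> {point D v}"
    proof
      fix z assume z: "z \<in> path_image (curve D e) \<inter> path_image (path_curve D (v # ys) es)"
      then obtain f where f: "f \<in> set es" "z \<in> path_image (curve D f)" using IH by blast
      have fe: "ends G f \<subseteq> set (v # ys)" using graph_path_ends_subset[OF P(1) f(1)] .
      then have "f \<noteq> e" using P(2,4) by blast
      moreover have "f \<in> edges G" using f P(1) by (auto simp: graph_path_def)
      ultimately have "z \<in> point D ` (ends G e \<inter> ends G f)"
        using path_image_curve_Int[OF P(3), of f] f z by blast
      then show "z \<in> {point D v}" using P(2,4) fe by auto
    qed
    have "arc (oriented_curve D u e +++ path_curve D (v # ys) es)"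
      by (rule arc_join) (use o IH pi in simp_all)
    then show ?thesis using IH o False xs by (simp add: path_image_join)
  qed
qed simp

lemma path_curve_Int:
  assumes P: "graph_path G xs es" "es \<noteq> []" and P': "graph_path G xs' es'" "es' \<noteq> []"
    and d: "set es \<inter> set es' = {}"
  shows "path_image (path_curve D xs es) \<inter> path_image (path_curve D xs' es')
    \<subseteq> point D ` (set xs \<inter> set xs')"
proof
  fix z assume "z \<in> path_image (path_curve D xs es) \<inter> path_image (path_curve D xs' es')"
  then obtain e e' where e: "e \<in> set es" "e' \<in> set es'" "z \<in> path_image (curve D e) \<inter> path_image (curve D e')"
    using path_curve[OF P] path_curve[OF P'] by auto
  then have "e \<in> edges G" "e' \<in> edges G" "e \<noteq> e'" using P P' d by (auto simp: graph_path_def)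
  then have "z \<in> point D ` (ends G e \<inter> ends G e')" using path_image_curve_Int e(3) by blast
  then show "z \<in> point D ` (set xs \<inter> set xs')"
    using graph_path_ends_subset[OF P(1) e(1)] graph_path_ends_subset[OF P'(1) e(2)] by blast
qed

lemma point_in_path_curve_iff:
  assumes P: "graph_path G xs es" "es \<noteq> []" and v: "v \<in> verts G"
  shows "point D v \<in> path_image (path_curve D xs es) \<longleftrightarrow> v \<in> set xs"
proof
  assume "point D v \<in> path_image (path_curve D xs es)"
  then obtain e where e: "e \<in> set es" "point D v \<in> path_image (curve D e)" using path_curve[OF P] by auto
  then have eG: "e \<in> edges G" using P by (auto simp: graph_path_def)
  have "point D v \<in> point D ` ends G e"
    using e(2) curve_avoids_verts[OF eG] v path_image_curve[OF eG] by blast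
  then have "v \<in> ends G e" using inj_point ends_subset[OF eG] v by (meson inj_on_image_mem_iff)
  then show "v \<in> set xs" using graph_path_ends_subset[OF P(1) e(1)] by blast
next
  assume "v \<in> set xs"
  then obtain i where i: "i < length xs" "v = xs ! i" by (metis in_set_conv_nth)
  have len: "length xs = Suc (length es)" "\<And>i. i < length es \<Longrightarrow> ends G (es ! i) = {xs ! i, xs ! Suc i}"
    using P(1) by (auto simp: graph_path_def)
  have "\<exists>e\<in>set es. v \<in> ends G e"
  proof (cases "i < length es")
    case True
    then show ?thesis using len(2)[OF True] i(2) by (intro bexI[of _ "es ! i"]) auto
  next
    case False
    then have "i = Suc (length es - 1)" "length es - 1 < length es" using len(1) i(1) P(2) by auto
    then show ?thesis using len(2)[of "length es - 1"] i(2) by (intro bexI[of _ "es ! (length es - 1)"]) auto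
  qed
  then obtain e where e: "e \<in> set es" "v \<in> ends G e" by blast
  then have "e \<in> edges G" using P by (auto simp: graph_path_def)
  then have "point D v \<in> path_image (curve D e)" using path_image_curve e(2) by blast
  then show "point D v \<in> path_image (path_curve D xs es)" using path_curve[OF P] e(1) by auto
qed

section \<open>Faces near a drawn point\<close>

lemma closed_drawn_part:
  assumes "V \<subseteq> verts G" "E \<subseteq> edges G"
  shows "closed (point D ` V \<union> (\<Union>e\<in>E. path_image (curve D e)))"
proof -
  have "finite V" "finite E" using assms finite_verts finite_edges finite_subset by auto
  then show ?thesis
    by (intro closed_Un closed_UN finite_imp_closed finite_imageI)
      (use assms simple_curve closed_simple_path_image in auto)
qed

lemma compact_drawn_set: "compact (drawn_set G D)"
proof -
  have "compact (path_image (curve D e))" if "e \<in> edges G" for e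
    using simple_curve[OF that] compact_simple_path_image by blast
  then show ?thesis unfolding drawn_set_def
    by (intro compact_Un) (simp_all add: finite_imp_compact finite_verts finite_edges compact_UN)
qed

text \<open>A finite union of closed sets with empty interior. It makes the union of the faces dense
  in the plane.\<close>

lemma interior_drawn_set: "interior (drawn_set G D) = {}"
proof -
  have "interior (\<Union>e\<in>E. path_image (curve D e)) = {}" if "finite E" "E \<subseteq> edges G" for E
    using that
  proof (induction E)
    case (insert e E)
    then have "interior (path_image (curve D e) \<union> (\<Union>e\<in>E. path_image (curve D e))) =
        interior (path_image (curve D e))"
      by (intro interior_closed_Un_empty_interior) (auto simp: simple_curve closed_simple_path_image)
    then show ?case using insert simple_curve interior_simple_path_image by auto
  qed simp
  then have "interior (\<Union>e\<in>edges G. path_image (curve D e)) = {}" using finite_edges by blast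
  moreover have "finite (point D ` verts G)" by (simp add: finite_verts)
  ultimately show ?thesis unfolding drawn_set_def
    by (simp add: interior_closed_Un_empty_interior finite_imp_closed empty_interior_finite)
qed

lemma face_props:
  assumes "F \<in> faces G D"
  shows "open F" "connected F" "F \<noteq> {}" "F \<inter> drawn_set G D = {}" "frontier F \<subseteq> drawn_set G D"
proof -
  have cl: "closed (drawn_set G D)" using compact_drawn_set compact_imp_closed by blast
  have F: "F \<in> components (- drawn_set G D)" using assms by (simp add: faces_def)
  show "open F" using open_components[OF _ F] cl by blast
  show "connected F" "F \<noteq> {}" using F in_components_connected in_components_nonempty by blast+
  show "F \<inter> drawn_set G D = {}" using in_components_subset[OF F] by blast
  show "frontier F \<subseteq> drawn_set G D" using frontier_of_components_closed_complement[OF cl F] .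
qed

text \<open>One inner point in the closure brings in the whole edge, by
  \<open>edge_in_closure\<close> with \<open>B\<close> the rest of the drawing; an open face
  disjoint from the edge then has it on its frontier.\<close>

lemma edge_below_face:
  assumes e: "e \<in> edges G" and t: "0 < t" "t < 1" and F: "F \<in> faces G D"
    and cl: "curve D e t \<in> closure F"
  shows "incident_le G D (Edge e) (Face F)"
proof -
  define B where "B = point D ` verts G \<union> (\<Union>f\<in>edges G - {e}. path_image (curve D f))"
  have "drawn_set G D = B \<union> path_image (curve D e)"
    using e by (auto simp: drawn_set_def B_def)
  then have "F \<in> components (- (B \<union> path_image (curve D e)))" using F by (simp add: faces_def)
  moreover have "closed B" unfolding B_def by (rule closed_drawn_part) auto
  moreover have "curve D e ` {0<..<1} \<inter> B = {}"
    using curve_avoids_verts[OF e] inner_curve_Int[OF e] unfolding B_def by blast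
  ultimately have "path_image (curve D e) \<subseteq> closure F"
    using edge_in_closure[OF simple_curve[OF e]] t cl by blast
  moreover have "path_image (curve D e) \<inter> F = {}" using face_props(4)[OF F] e by (auto simp: drawn_set_def)
  ultimately show ?thesis using face_props(1)[OF F] by (auto simp: frontier_def interior_open)
qed

text \<open>A small disc that meets a face also meets its frontier, necessarily in a drawn point of a cell
  at the centre.\<close>

lemma nearby_faces_above_edge:
  assumes e: "e \<in> edges G" and t: "0 < t" "t < 1"
  obtains r where "r > 0"
    "\<And>F. F \<in> faces G D \<Longrightarrow> F \<inter> ball (curve D e t) r \<noteq> {} \<Longrightarrow> incident_le G D (Edge e) (Face F)"
proof -
  let ?q = "curve D e t"
  define B where "B = point D ` verts G \<union> (\<Union>f\<in>edges G - {e}. path_image (curve D f))"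
  have "closed B" unfolding B_def by (rule closed_drawn_part) auto
  moreover have "?q \<in> curve D e ` {0<..<1}" using t by simp
  then have "?q \<notin> B"
    using curve_avoids_verts[OF e] inner_curve_Int[OF e] unfolding B_def by blast
  ultimately obtain r where r: "r > 0" "ball ?q r \<subseteq> - B"
    by (meson ComplI open_Compl openE)
  show thesis
  proof
    show "r > 0" by fact
    fix F assume F: "F \<in> faces G D" "F \<inter> ball ?q r \<noteq> {}"
    have "?q \<in> path_image (curve D e)" using t by (auto simp: path_image_def)
    then have "?q \<notin> F" using face_props(4)[OF F(1)] e by (auto simp: drawn_set_def)
    then have "?q \<in> ball ?q r - F" using r(1) by simp
    then have "ball ?q r - F \<noteq> {}" by blast
    moreover have "ball ?q r \<inter> F \<noteq> {}" using F(2) by (simp add: Int_commute)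
    ultimately have "ball ?q r \<inter> frontier F \<noteq> {}"
      by (intro connected_Int_frontier connected_ball)
    then obtain z where z: "z \<in> ball ?q r" "z \<in> frontier F" by blast
    then have "z \<in> drawn_set G D" "z \<notin> B" using face_props(5)[OF F(1)] r(2) by blast+
    then have "z \<in> path_image (curve D e)" by (auto simp: drawn_set_def B_def)
    moreover have "z \<notin> point D ` ends G e" using \<open>z \<notin> B\<close> ends_subset[OF e] by (auto simp: B_def)
    ultimately obtain x where "0 < x" "x < 1" "z = curve D e x" using path_image_curve[OF e] by auto
    then show "incident_le G D (Edge e) (Face F)"
      using edge_below_face[OF e _ _ F(1)] z(2) by (auto simp: frontier_def)
  qed
qed

lemma nearby_faces_above_vertex:
  assumes v: "v \<in> verts G"
  obtains r where "r > 0"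
    "\<And>F. F \<in> faces G D \<Longrightarrow> F \<inter> ball (point D v) r \<noteq> {} \<Longrightarrow> incident_le G D (Vertex v) (Face F)"
proof -
  let ?q = "point D v"
  \<comment> \<open>Everything drawn except \<open>v\<close> and the edges at \<open>v\<close>; near
    \<open>v\<close>, frontier points can only come from these.\<close>
  define B where "B = point D ` (verts G - {v}) \<union> (\<Union>f\<in>{f\<in>edges G. v \<notin> ends G f}. path_image (curve D f))"
  have "closed B" unfolding B_def by (rule closed_drawn_part) auto
  moreover have "?q \<notin> B"
  proof
    assume "?q \<in> B"
    then consider w where "w \<in> verts G" "w \<noteq> v" "?q = point D w"
      | f where "f \<in> edges G" "v \<notin> ends G f" "?q \<in> path_image (curve D f)"
      by (auto simp: B_def)
    then show False
    proof cases
      case 1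
      then show ?thesis using inj_point v by (auto simp: inj_on_def)
    next
      case 2
      then have "?q \<in> point D ` ends G f" using curve_avoids_verts[OF 2(1)] v path_image_curve[OF 2(1)] by blast
      then show ?thesis using 2 inj_point ends_subset[OF 2(1)] v by (meson inj_on_image_mem_iff)
    qed
  qed
  ultimately obtain r where r: "r > 0" "ball ?q r \<subseteq> - B"
    by (meson ComplI open_Compl openE)
  show thesis
  proof
    show "r > 0" by fact
    fix F assume F: "F \<in> faces G D" "F \<inter> ball ?q r \<noteq> {}"
    have "?q \<notin> F" using face_props(4)[OF F(1)] v by (auto simp: drawn_set_def)
    then have "?q \<in> ball ?q r - F" using r(1) by simp
    then have "ball ?q r - F \<noteq> {}" by blast
    moreover have "ball ?q r \<inter> F \<noteq> {}" using F(2) by (simp add: Int_commute)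
    ultimately have "ball ?q r \<inter> frontier F \<noteq> {}"
      by (intro connected_Int_frontier connected_ball)
    then obtain z where z: "z \<in> ball ?q r" "z \<in> frontier F" by blast
    then have "z \<in> drawn_set G D" "z \<notin> B" using face_props(5)[OF F(1)] r(2) by blast+
    show "incident_le G D (Vertex v) (Face F)"
    proof (cases "z = ?q")
      case True
      then show ?thesis using z by simp
    next
      case False
      then have zn: "z \<notin> point D ` verts G" using \<open>z \<notin> B\<close> by (auto simp: B_def)
      then obtain f where f: "f \<in> edges G" "v \<in> ends G f" "z \<in> path_image (curve D f)"
        using \<open>z \<in> drawn_set G D\<close> \<open>z \<notin> B\<close> by (auto simp: B_def drawn_set_def)
      moreover have "z \<notin> point D ` ends G f" using zn ends_subset[OF f(1)] by blast
      ultimately obtain x where "0 < x" "x < 1" "z = curve D f x" using path_image_curve[OF f(1)] by auto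
      \<comment> \<open>The edge brings its end \<open>v\<close> onto the frontier along with
        it.\<close>
      then have "path_image (curve D f) \<subseteq> frontier F"
        using edge_below_face[OF f(1) _ _ F(1)] z(2) by (auto simp: frontier_def)
      moreover have "?q \<in> path_image (curve D f)" using f path_image_curve[OF f(1)] by blast
      ultimately show ?thesis by auto
    qed
  qed
qed

end

section \<open>Theta graphs\<close>

lemma graph_path_rev:
  assumes "graph_path G xs es"
  shows "graph_path G (rev xs) (rev es)"
proof -
  have len: "length xs = Suc (length es)" using assms by (simp add: graph_path_def)
  have "ends G (rev es ! i) = {rev xs ! i, rev xs ! Suc i}" if i: "i < length es" for i
  proof -
    define k where "k = length es - Suc i"
    have k: "k < length es" "length xs - Suc i = Suc k" "length xs - Suc (Suc i) = k"
      using i len by (auto simp: k_def)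
    have "ends G (es ! k) = {xs ! k, xs ! Suc k}" using assms k(1) by (simp add: graph_path_def)
    then show ?thesis using i len k by (auto simp: rev_nth k_def[symmetric])
  qed
  then show ?thesis using assms by (simp add: graph_path_def)
qed

lemma graph_path_append:
  assumes P: "graph_path G xs es" and Q: "graph_path G ys fs"
    and m: "last xs = hd ys" "set xs \<inter> set ys = {last xs}"
  shows "graph_path G (xs @ tl ys) (es @ fs)"
proof -
  have len: "length xs = Suc (length es)" "length ys = Suc (length fs)"
    using P Q by (auto simp: graph_path_def)
  then obtain y ys' where ys: "ys = y # ys'" by (cases ys) auto
  have dist: "distinct xs" "distinct ys" using P Q by (auto simp: graph_path_def)
  have "set xs \<inter> set ys' = {}"
  proof (rule ccontr)
    assume "set xs \<inter> set ys' \<noteq> {}"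
    then obtain z where "z \<in> set xs" "z \<in> set ys'" by blast
    then have "z = y" using m ys by auto
    with \<open>z \<in> set ys'\<close> dist(2) ys show False by simp
  qed
  then have "distinct (xs @ tl ys)" using dist ys by simp
  moreover have "ends G ((es @ fs) ! i) = {(xs @ tl ys) ! i, (xs @ tl ys) ! Suc i}"
    if i: "i < length (es @ fs)" for i
  proof (cases "i < length es")
    case True
    then have "ends G (es ! i) = {xs ! i, xs ! Suc i}" using P by (simp add: graph_path_def)
    then show ?thesis using True len by (simp add: nth_append)
  next
    case False
    then obtain j where j: "i = length es + j" using le_Suc_ex not_less by blast
    then have jl: "j < length fs" using i by simp
    have "ends G (fs ! j) = {ys ! j, ys ! Suc j}" using Q jl by (simp add: graph_path_def)
    moreover have "(xs @ tl ys) ! (length es + j) = ys ! j"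
    proof (cases j)
      case 0
      have "xs \<noteq> []" using len by auto
      then have "xs ! length es = last xs" using len by (simp add: last_conv_nth)
      then show ?thesis using 0 len m ys by (simp add: nth_append)
    next
      case (Suc k)
      then show ?thesis using len ys by (simp add: nth_append)
    qed
    moreover have "(xs @ tl ys) ! Suc (length es + j) = ys ! Suc j"
      using len ys by (simp add: nth_append)
    ultimately show ?thesis using j False by (simp add: nth_append)
  qed
  ultimately show ?thesis using P Q len ys by (auto simp: graph_path_def)
qed

lemma graph_path_between:
  assumes "graph_path G xs es" "{hd xs, last xs} = {u, v}"
  obtains xs' es' where "graph_path G xs' es'" "hd xs' = u" "last xs' = v" "set xs' = set xs"
    "set es' = set es"
proof (cases "hd xs = u \<and> last xs = v")
  case True
  then show ?thesis using that assms by blast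
next
  case False
  have ne: "xs \<noteq> []" using assms by (auto simp: graph_path_def)
  have "hd xs = v" "last xs = u" using assms(2) False by (auto simp: doubleton_eq_iff)
  then show ?thesis using that[OF graph_path_rev[OF assms(1)]] ne by (simp add: hd_rev last_rev)
qed

text \<open>The two branch vertices of the smaller class become the common ends. The two subdivided
  edges at a branch vertex \<open>r j\<close> of the larger class combine into one path, so each of
  the three paths has the inner vertex \<open>r j\<close>.\<close>

lemma theta_of_subdivision:
  fixes H :: "('v, 'e) multigraph"
  assumes "is_subdivision H (complete_bipartite 2 3)"
  obtains a b m xs es where "a \<noteq> b"
    "\<And>j. j < 3 \<Longrightarrow> graph_path H (xs j) (es j) \<and> hd (xs j) = a \<and> last (xs j) = b \<and> m j \<in> set (xs j) - {a, b}"
    "\<And>j k. j < 3 \<Longrightarrow> k < 3 \<Longrightarrow> j \<noteq> k \<Longrightarrow> set (xs j) \<inter> set (xs k) = {a, b} \<and> set (es j) \<inter> set (es k) = {}"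
    "edges H = (\<Union>j<3::nat. set (es j))"
proof -
  let ?K = "complete_bipartite 2 3"
  have vK: "verts ?K = Inl ` {..<2} \<union> Inr ` {..<3}" and eK: "edges ?K = {..<2} \<times> {..<3}"
    and dK: "ends ?K (i, j) = {Inl i, Inr j}" for i j
    by (simp_all add: complete_bipartite_def)
  obtain b P Q where inj: "inj_on b (verts ?K)"
    and path': "\<forall>e\<in>edges ?K. graph_path H (P e) (Q e) \<and> {hd (P e), last (P e)} = b ` ends ?K e \<and>
           inner_verts (P e) \<inter> b ` verts ?K = {}"
    and disj': "\<forall>e\<in>edges ?K. \<forall>e'\<in>edges ?K. e \<noteq> e' \<longrightarrow>
           inner_verts (P e) \<inter> inner_verts (P e') = {} \<and> set (Q e) \<inter> set (Q e') = {}"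
    and edges: "edges H = (\<Union>e\<in>edges ?K. set (Q e))"
    using assms unfolding is_subdivision_def by (elim exE conjE) (rule that)
  note path = bspec[OF path'] and disj = mp[OF bspec[OF bspec[OF disj']]]
  define A where "A i j = inner_verts (P (i, j))" for i j
  define l where "l i = b (Inl i)" for i
  define r where "r j = b (Inr j)" for j
  have setP: "set (P (i, j)) = A i j \<union> {l i, r j}" if "i < 2" "j < 3" for i j
  proof -
    have "graph_path H (P (i, j)) (Q (i, j))" "{hd (P (i, j)), last (P (i, j))} = {l i, r j}"
      using path[of "(i, j)"] that dK by (auto simp: eK l_def r_def)
    moreover from this(1) have "P (i, j) \<noteq> []" by (auto simp: graph_path_def)
    ultimately show ?thesis unfolding A_def inner_verts_def by (metis Diff_partition hd_in_set last_in_set insert_subset empty_subsetI sup_commute)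
  qed
  have lr: "l i \<noteq> r j" if "i < 2" "j < 3" for i j
    using inj_onD[OF inj, of "Inl i" "Inr j"] that by (auto simp: l_def r_def vK)
  have ll: "l 0 \<noteq> l 1"
    using inj_onD[OF inj, of "Inl 0" "Inl 1"] by (auto simp: l_def vK)
  have rr: "r j \<noteq> r k" if "j < 3" "k < 3" "j \<noteq> k" for j k
    using inj_onD[OF inj, of "Inr j" "Inr k"] that by (auto simp: r_def vK)
  have Ab: "A i j \<inter> b ` verts ?K = {}" if "i < 2" "j < 3" for i j
    using path[of "(i, j)"] that by (simp add: eK A_def)
  have Al: "l i' \<notin> A i j" if "i < 2" "j < 3" "i' < 2" for i j i'
  proof -
    have "l i' \<in> b ` verts ?K" using that by (auto simp: vK l_def)
    then show ?thesis using Ab[OF that(1,2)] by blast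
  qed
  have Ar: "r j' \<notin> A i j" if "i < 2" "j < 3" "j' < 3" for i j j'
  proof -
    have "r j' \<in> b ` verts ?K" using that by (auto simp: vK r_def)
    then show ?thesis using Ab[OF that(1,2)] by blast
  qed
  have AA: "A i j \<inter> A i' j' = {}" "set (Q (i, j)) \<inter> set (Q (i', j')) = {}"
    if "i < 2" "j < 3" "i' < 2" "j' < 3" "(i, j) \<noteq> (i', j')" for i j i' j'
    using disj[of "(i, j)" "(i', j')"] that by (simp_all add: eK A_def)
  have "\<exists>xs es. graph_path H xs es \<and> hd xs = l 0 \<and> last xs = l 1 \<and>
      set xs = A 0 j \<union> A 1 j \<union> {l 0, l 1, r j} \<and> set es = set (Q (0, j)) \<union> set (Q (1, j))"
    if j: "j < 3" for j
  proof -
    have e0: "{hd (P (0, j)), last (P (0, j))} = {l 0, r j}" "graph_path H (P (0, j)) (Q (0, j))"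
      using path[of "(0, j)"] j dK by (auto simp: eK l_def r_def)
    have e1: "{hd (P (1, j)), last (P (1, j))} = {r j, l 1}" "graph_path H (P (1, j)) (Q (1, j))"
      using path[of "(1, j)"] j dK by (auto simp: eK l_def r_def)
    obtain xs es where xs: "graph_path H xs es" "hd xs = l 0" "last xs = r j" "set xs = set (P (0, j))"
      "set es = set (Q (0, j))" using graph_path_between[OF e0(2,1)] .
    obtain ys fs where ys: "graph_path H ys fs" "hd ys = r j" "last ys = l 1" "set ys = set (P (1, j))"
      "set fs = set (Q (1, j))" using graph_path_between[OF e1(2,1)] .
    have sx: "set xs = A 0 j \<union> {l 0, r j}" and sy: "set ys = A 1 j \<union> {l 1, r j}"
      using xs(4) ys(4) setP j by auto
    have "set xs \<inter> set ys = {last xs}"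
    proof -
      have "A 0 j \<inter> A 1 j = {}" "l 1 \<notin> A 0 j" "r j \<notin> A 0 j" "l 0 \<notin> A 1 j" "r j \<notin> A 1 j"
        using AA(1)[of 0 j 1 j] Al Ar j by simp_all
      then show ?thesis unfolding sx sy xs(3) using ll lr[of 0 j] lr[of 1 j] j by blast
    qed
    then have gp: "graph_path H (xs @ tl ys) (es @ fs)"
      using graph_path_append[OF xs(1) ys(1)] xs(3) ys(2) by simp
    have ne: "xs \<noteq> []" "ys \<noteq> []" using xs(1) ys(1) by (auto simp: graph_path_def)
    then obtain ys' where ys': "ys = r j # ys'" using ys(2) by (cases ys) auto
    have "ys' \<noteq> []" using ys' ys(3) lr[of 1 j] j by auto
    then have "last (xs @ tl ys) = l 1" using ys' ys(3) by simp
    moreover have "hd (xs @ tl ys) = l 0" using xs(2) ne by simp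
    moreover have "set (xs @ tl ys) = set xs \<union> set ys" using ys' sx by auto
    then have "set (xs @ tl ys) = A 0 j \<union> A 1 j \<union> {l 0, l 1, r j}" using sx sy by auto
    ultimately show ?thesis using gp xs(5) ys(5) by (intro exI[of _ "xs @ tl ys"] exI[of _ "es @ fs"]) simp
  qed
  then obtain xs es where xe: "\<And>j. j < 3 \<Longrightarrow> graph_path H (xs j) (es j) \<and> hd (xs j) = l 0 \<and>
      last (xs j) = l 1 \<and> set (xs j) = A 0 j \<union> A 1 j \<union> {l 0, l 1, r j} \<and>
      set (es j) = set (Q (0, j)) \<union> set (Q (1, j))"
    by metis
  show thesis
  proof (rule that[of "l 0" "l 1" xs es r])
    show "l 0 \<noteq> l 1" by (rule ll)
    show "graph_path H (xs j) (es j) \<and> hd (xs j) = l 0 \<and> last (xs j) = l 1 \<and> r j \<in> set (xs j) - {l 0, l 1}"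
      if "j < 3" for j
      using xe[OF that] lr[of 0 j] lr[of 1 j] that by auto
    show "set (xs j) \<inter> set (xs k) = {l 0, l 1} \<and> set (es j) \<inter> set (es k) = {}"
      if jk: "j < 3" "k < 3" "j \<noteq> k" for j k
    proof
      have AAs: "A i j \<inter> A i' k = {}" "set (Q (i, j)) \<inter> set (Q (i', k)) = {}" if "i < 2" "i' < 2" for i i'
        using AA[of i j i' k] jk that by auto
      show "set (xs j) \<inter> set (xs k) = {l 0, l 1}"
      proof -
        have d: "A 0 j \<inter> A 0 k = {}" "A 0 j \<inter> A 1 k = {}" "A 1 j \<inter> A 0 k = {}" "A 1 j \<inter> A 1 k = {}"
          by (simp_all add: AAs)
        have n: "l 0 \<notin> A 0 j" "l 0 \<notin> A 1 j" "l 1 \<notin> A 0 j" "l 1 \<notin> A 1 j" "r k \<notin> A 0 j" "r k \<notin> A 1 j"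
          "l 0 \<notin> A 0 k" "l 0 \<notin> A 1 k" "l 1 \<notin> A 0 k" "l 1 \<notin> A 1 k" "r j \<notin> A 0 k" "r j \<notin> A 1 k"
          using Al Ar jk by simp_all
        have lrs: "l 0 \<noteq> r j" "l 1 \<noteq> r j" "l 0 \<noteq> r k" "l 1 \<noteq> r k" using lr jk by simp_all
        have sets: "set (xs j) = A 0 j \<union> A 1 j \<union> {l 0, l 1, r j}"
          "set (xs k) = A 0 k \<union> A 1 k \<union> {l 0, l 1, r k}"
          using xe[OF jk(1)] xe[OF jk(2)] by blast+
        show ?thesis unfolding sets
          using d n lrs lrs[symmetric] rr[OF jk] rr[OF jk, symmetric]
          by (simp add: Int_Un_distrib Int_Un_distrib2 insert_commute)
      qed
      show "set (es j) \<inter> set (es k) = {}"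
      proof -
        have "set (Q (0, j)) \<inter> set (Q (0, k)) = {}" "set (Q (0, j)) \<inter> set (Q (1, k)) = {}"
          "set (Q (1, j)) \<inter> set (Q (0, k)) = {}" "set (Q (1, j)) \<inter> set (Q (1, k)) = {}"
          by (simp_all add: AAs)
        moreover have "set (es j) = set (Q (0, j)) \<union> set (Q (1, j))" "set (es k) = set (Q (0, k)) \<union> set (Q (1, k))"
          using xe[OF jk(1)] xe[OF jk(2)] by blast+
        ultimately show ?thesis by (simp add: Int_Un_distrib Int_Un_distrib2)
      qed
    qed
    have "{..<2::nat} = {0, 1}" by auto
    then have "edges H = (\<Union>j<3. set (Q (0, j)) \<union> set (Q (1, j)))" unfolding edges eK by auto
    then show "edges H = (\<Union>j<3. set (es j))" using xe by auto
  qed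
qed

section \<open>Realizers of size three\<close>

locale three_realizer = planar_map G D for G :: "('v, 'e) multigraph" (structure) and D +
  fixes L :: "3 \<Rightarrow> ('v, 'e) cell rel"
  assumes linear: "linear_order_on (cells G D) (L s)"
    and intersection: "(\<Inter>s. L s) = P_VEF G D"
begin

lemma incident_below:
  "incident_le G D x y \<Longrightarrow> x \<in> cells G D \<Longrightarrow> y \<in> cells G D \<Longrightarrow> (x, y) \<in> L s"
  using intersection by (auto simp: P_VEF_def)

text \<open>A missing relation fails in at least one order of the realizer, and totality reverses it
  there.\<close>

lemma not_incident_above:
  assumes "\<not> incident_le G D x y" "x \<in> cells G D" "y \<in> cells G D"
  obtains s where "(y, x) \<in> L s" "x \<noteq> y"
proof -
  have "(x, y) \<notin> P_VEF G D" using assms by (simp add: P_VEF_def)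
  then obtain s where s: "(x, y) \<notin> L s" using intersection by blast
  have "refl_on (cells G D) (L s)" "total_on (cells G D) (L s)"
    using linear[of s] by (auto simp: linear_order_on_def partial_order_on_def preorder_on_def)
  then have "x \<noteq> y" "(y, x) \<in> L s"
    using s assms(2,3) unfolding refl_on_def total_on_def by metis+
  then show thesis using that by blast
qed

lemma below_all_incident:
  assumes "\<And>s. (x, y) \<in> L s"
  shows "incident_le G D x y"
proof -
  have "(x, y) \<in> P_VEF G D" using assms intersection by blast
  then show ?thesis by (simp add: P_VEF_def)
qed

lemma trans_L: "(x, y) \<in> L s \<Longrightarrow> (y, z) \<in> L s \<Longrightarrow> (x, z) \<in> L s"
  using linear[of s] by (auto simp: linear_order_on_def partial_order_on_def preorder_on_def dest: transD)

lemma antisym_L: "(x, y) \<in> L s \<Longrightarrow> (y, x) \<in> L s \<Longrightarrow> x = y"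
  using linear[of s] by (auto simp: linear_order_on_def partial_order_on_def dest: antisymD)

definition rank :: "3 \<Rightarrow> 'v \<Rightarrow> real" where
  "rank s v = real (card {w \<in> verts G. (Vertex w, Vertex v) \<in> L s})"

lemma cells_simps [simp]:
  "Vertex v \<in> cells G D \<longleftrightarrow> v \<in> verts G" "Edge e \<in> cells G D \<longleftrightarrow> e \<in> edges G"
  "Face f \<in> cells G D \<longleftrightarrow> f \<in> faces G D"
  by (auto simp: cells_def)

lemma rank_less:
  assumes "v \<in> verts G" "w \<in> verts G" "(Vertex v, Vertex w) \<in> L s" "v \<noteq> w"
  shows "rank s v < rank s w"
proof -
  have "{u \<in> verts G. (Vertex u, Vertex v) \<in> L s} \<subseteq> {u \<in> verts G. (Vertex u, Vertex w) \<in> L s}"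
    using assms(3) trans_L by blast
  moreover have "(Vertex w, Vertex w) \<in> L s"
    using assms(2) incident_below[of "Vertex w" "Vertex w"] by simp
  moreover have "(Vertex w, Vertex v) \<notin> L s" using antisym_L assms(3,4) by blast
  ultimately have "{u \<in> verts G. (Vertex u, Vertex v) \<in> L s} \<subset> {u \<in> verts G. (Vertex u, Vertex w) \<in> L s}"
    using assms(2) by blast
  then show ?thesis unfolding rank_def using finite_verts by (simp add: psubset_card_mono)
qed

lemma rank_vertex_above_vertex:
  assumes "v \<in> verts G" "w \<in> verts G" "v \<noteq> w"
  shows "\<exists>s. rank s w < rank s v"
proof -
  have "\<not> incident_le G D (Vertex v) (Vertex w)" using assms by simp
  then obtain s where "(Vertex w, Vertex v) \<in> L s" by (rule not_incident_above) (use assms in auto)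
  then show ?thesis using rank_less assms by blast
qed

lemma rank_vertex_above_cell:
  assumes "(c, Vertex x) \<in> L s" "incident_le G D (Vertex u) c" "c \<in> cells G D" "u \<in> verts G"
    "x \<in> verts G" "u \<noteq> x"
  shows "rank s u < rank s x"
  using rank_less[OF assms(4,5) trans_L[OF incident_below[OF assms(2)] assms(1)] assms(6)] assms by simp

lemma rank_vertex_above_edge:
  assumes e: "e \<in> edges G" "ends G e = {u, v}" and w: "w \<in> verts G" "w \<notin> {u, v}"
  shows "\<exists>s. max (rank s u) (rank s v) < rank s w"
proof -
  have "\<not> incident_le G D (Vertex w) (Edge e)" using e w by simp
  then obtain s where s: "(Edge e, Vertex w) \<in> L s" by (rule not_incident_above) (use e w in auto)
  have "u \<in> verts G" "v \<in> verts G" using ends_subset[OF e(1)] e(2) by auto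
  then have "rank s u < rank s w" "rank s v < rank s w"
    using rank_vertex_above_cell[OF s] e w by auto
  then show ?thesis by (meson max_less_iff_conj)
qed

end

section \<open>One side of a cycle covered by three closed sets\<close>

locale cycle_avoiding = three_realizer G D L for G :: "('v, 'e) multigraph" (structure) and D L +
  fixes c :: "real \<Rightarrow> complex" and E :: "'e set" and x :: 'v and \<Omega> :: "complex set"
  assumes simple_c: "simple_path c" and loop_c: "pathfinish c = pathstart c"
    and E: "E \<subseteq> edges G" "path_image c = (\<Union>e\<in>E. path_image (curve D e))"
    and x: "x \<in> verts G" "point D x \<notin> path_image c" "point D x \<notin> \<Omega>"
    and side: "\<Omega> = inside (path_image c) \<or> \<Omega> = outside (path_image c)"
begin

lemma \<Omega>: "open \<Omega>" "frontier \<Omega> = path_image c"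
  using side Jordan_inside_outside[OF simple_c loop_c] by metis+

lemma closure_\<Omega>: "closure \<Omega> = \<Omega> \<union> path_image c"
  using \<Omega>(2) closure_Un_frontier[of \<Omega>] by simp

lemma image_c_drawn: "path_image c \<subseteq> drawn_set G D"
  using E by (auto simp: drawn_set_def)

lemma face_in_side:
  assumes "F \<in> faces G D" "F \<inter> \<Omega> \<noteq> {}"
  shows "F \<subseteq> \<Omega>"
proof -
  have "F \<inter> frontier \<Omega> = {}" using face_props(4)[OF assms(1)] image_c_drawn \<Omega>(2) by blast
  then show ?thesis using connected_Int_frontier[OF face_props(2)[OF assms(1)] assms(2)] by blast
qed

definition U :: "3 \<Rightarrow> complex set" where
  "U s = closure (\<Union>{F \<in> faces G D. F \<subseteq> \<Omega> \<and> (Face F, Vertex x) \<in> L s})"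

lemma closed_U: "closed (U s)" by (simp add: U_def)

lemma closure_face_subset_U:
  "F \<in> faces G D \<Longrightarrow> F \<subseteq> \<Omega> \<Longrightarrow> (Face F, Vertex x) \<in> L s \<Longrightarrow> closure F \<subseteq> U s"
  unfolding U_def by (rule closure_mono) blast

lemma U_subset: "U s \<subseteq> closure \<Omega>"
  unfolding U_def by (rule closure_mono) blast

lemma U_meets:
  assumes "z \<in> U s" "r > 0"
  obtains F where "F \<in> faces G D" "F \<subseteq> \<Omega>" "(Face F, Vertex x) \<in> L s" "F \<inter> ball z r \<noteq> {}"
proof -
  obtain y where "y \<in> \<Union>{F \<in> faces G D. F \<subseteq> \<Omega> \<and> (Face F, Vertex x) \<in> L s}" "dist y z < r"
    using assms unfolding U_def closure_approachable by blast
  then show thesis using that by (auto simp: dist_commute disjoint_iff)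
qed

text \<open>The frontier of \<open>F\<close> stays in the closure of \<open>\<Omega>\<close>, which
  does not contain the point of \<open>x\<close>.\<close>

lemma face_not_above:
  assumes "F \<in> faces G D" "F \<subseteq> \<Omega>"
  obtains s where "(Face F, Vertex x) \<in> L s"
proof -
  have "frontier F \<subseteq> \<Omega> \<union> path_image c"
    using closure_mono[OF assms(2)] by (auto simp: frontier_def closure_\<Omega>)
  then have "\<not> incident_le G D (Vertex x) (Face F)" using x by auto
  then show thesis by (rule not_incident_above) (use assms x that in auto)
qed

text \<open>Faces are dense and a finite union of closed sets is closed, so covering the faces in
  \<open>\<Omega>\<close> suffices.\<close>

lemma U_covers: "\<Omega> \<union> path_image c \<subseteq> (\<Union>s. U s)"
proof -
  have "\<Omega> \<inter> - drawn_set G D \<subseteq> (\<Union>s. U s)"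
  proof
    fix z assume z: "z \<in> \<Omega> \<inter> - drawn_set G D"
    then obtain F where F: "F \<in> faces G D" "z \<in> F" using Union_components unfolding faces_def by blast
    with z have "F \<subseteq> \<Omega>" using face_in_side by blast
    then obtain s where "closure F \<subseteq> U s"
      using face_not_above[OF F(1)] closure_face_subset_U[OF F(1)] by metis
    then show "z \<in> (\<Union>s. U s)" using F(2) closure_subset by blast
  qed
  moreover have "closed (\<Union>s. U s)" by (intro closed_UN) (auto simp: closed_U)
  ultimately have 1: "closure (\<Omega> \<inter> - drawn_set G D) \<subseteq> (\<Union>s. U s)" by (rule closure_minimal)
  have "closure (- drawn_set G D) = UNIV" by (simp add: closure_complement interior_drawn_set)
  then have "\<Omega> \<subseteq> closure (\<Omega> \<inter> - drawn_set G D)"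
    using open_Int_closure_subset[OF \<Omega>(1), of "- drawn_set G D"] by simp
  then have "closure \<Omega> \<subseteq> closure (\<Omega> \<inter> - drawn_set G D)" by (rule closure_minimal) simp
  with 1 show ?thesis unfolding closure_\<Omega> by (rule subset_trans[rotated])
qed

text \<open>Take the cell containing a common point. For each \<open>s\<close>, a nearby face lies
  above this cell (or equals it) and below \<open>x\<close> in \<open>L s\<close>. Thus the cell is
  below \<open>x\<close> in all three orders, hence incident with \<open>x\<close>, hence
  \<open>x\<close> itself, whose point is not in the closure of \<open>\<Omega>\<close>.\<close>

lemma U_no_common_point: "\<exists>s. z \<notin> U s"
proof (rule ccontr)
  assume "\<nexists>s. z \<notin> U s"
  then have all: "z \<in> U s" for s by blast
  consider "z \<notin> drawn_set G D" | v where "v \<in> verts G" "z = point D v"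
    | e t where "e \<in> edges G" "0 < t" "t < 1" "z = curve D e t"
  proof -
    have "z \<in> point D ` verts G \<or> (\<exists>e\<in>edges G. z \<in> curve D e ` {0<..<1})"
      if zd: "z \<in> drawn_set G D"
    proof -
      consider "z \<in> point D ` verts G" | e where "e \<in> edges G" "z \<in> path_image (curve D e)"
        using zd unfolding drawn_set_def by blast
      then show ?thesis
      proof cases
        case 2
        then show ?thesis using path_image_curve[OF 2(1)] ends_subset[OF 2(1)] by (metis UnE image_mono subsetD)
      qed simp
    qed
    then show thesis using that by force
  qed
  then show False
  proof cases
    case 1
    then obtain F where F: "F \<in> faces G D" "z \<in> F" using Union_components unfolding faces_def by blast
    obtain r where r: "r > 0" "ball z r \<subseteq> F" using face_props(1)[OF F(1)] F(2) openE by blast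
    have "(Face F, Vertex x) \<in> L s" for s
    proof -
      obtain F' where F': "F' \<in> faces G D" "(Face F', Vertex x) \<in> L s" "F' \<inter> ball z r \<noteq> {}"
        using U_meets[OF all r(1)] .
      then have "F' = F" using r(2) F components_nonoverlap[of F' "- drawn_set G D" F]
        unfolding faces_def by blast
      with F' show ?thesis by simp
    qed
    then show False using below_all_incident[of "Face F" "Vertex x"] by simp
  next
    case (2 v)
    obtain r where r: "r > 0"
      "\<And>F. F \<in> faces G D \<Longrightarrow> F \<inter> ball (point D v) r \<noteq> {} \<Longrightarrow> incident_le G D (Vertex v) (Face F)"
      using nearby_faces_above_vertex[OF 2(1)] by metis
    have "(Vertex v, Vertex x) \<in> L s" for s
    proof -
      obtain F where F: "F \<in> faces G D" "(Face F, Vertex x) \<in> L s" "F \<inter> ball z r \<noteq> {}"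
        using U_meets[OF all r(1)] .
      then have "(Vertex v, Face F) \<in> L s" using r(2)[of F] 2 by (intro incident_below) auto
      then show ?thesis using F(2) trans_L by blast
    qed
    then have "v = x" using below_all_incident[of "Vertex v" "Vertex x"] by simp
    moreover have "z \<in> closure \<Omega>" using all[of 1] U_subset by blast
    ultimately show False using x 2 by (auto simp: closure_\<Omega>)
  next
    case (3 e t)
    obtain r where r: "r > 0"
      "\<And>F. F \<in> faces G D \<Longrightarrow> F \<inter> ball (curve D e t) r \<noteq> {} \<Longrightarrow> incident_le G D (Edge e) (Face F)"
      using nearby_faces_above_edge[OF 3(1-3)] by metis
    have "(Edge e, Vertex x) \<in> L s" for s
    proof -
      obtain F where F: "F \<in> faces G D" "(Face F, Vertex x) \<in> L s" "F \<inter> ball z r \<noteq> {}"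
        using U_meets[OF all r(1)] .
      then have "(Edge e, Face F) \<in> L s" using r(2)[of F] 3 by (intro incident_below) auto
      then show ?thesis using F(2) trans_L by blast
    qed
    then show False using below_all_incident[of "Edge e" "Vertex x"] by simp
  qed
qed

text \<open>The case distinction is needed because \<^const>\<open>infdist\<close> to the empty set is \<open>0\<close>; the cut-off at
  \<open>1\<close> makes the functions constant near infinity.\<close>

definition dist_U :: "complex \<Rightarrow> 3 \<Rightarrow> real" where
  "dist_U z s = (if U s = {} then 1 else min 1 (infdist z (U s)))"

lemma dist_U_eq_0_iff: "dist_U z s = 0 \<longleftrightarrow> z \<in> U s"
  using in_closed_iff_infdist_zero[OF closed_U, of s z] by (simp add: dist_U_def min_def)

lemma dist_U_nonneg: "dist_U z s \<ge> 0"
  by (simp add: dist_U_def infdist_nonneg)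

definition g :: "complex \<Rightarrow> complex" where
  "g z = proj3 (dist_U z)"

lemma continuous_g: "continuous_on S g"
proof -
  have "continuous_on S (\<lambda>z. dist_U z s)" for s
    unfolding dist_U_def by (cases "U s = {}") (auto intro!: continuous_intros)
  then show ?thesis unfolding g_def proj3_def by (intro continuous_intros continuous_on_Complex)
qed

text \<open>A zero of the projection means three equal distances. One of them is \<open>0\<close>
  because the sets cover, so all are, and the sets would have a common point.\<close>

lemma g_nonzero:
  assumes "z \<in> \<Omega> \<union> path_image c"
  shows "g z \<noteq> 0"
proof
  assume "g z = 0"
  then have "proj3 (dist_U z) = proj3 (\<lambda>_. 0)" by (simp add: g_def proj3_def Complex_eq_0)
  then obtain t where t: "\<And>s. dist_U z s = t" unfolding proj3_eq_iff by auto
  obtain s where "z \<in> U s" using assms U_covers by blast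
  then have "t = 0" using t dist_U_eq_0_iff by metis
  then show False using t dist_U_eq_0_iff U_no_common_point by metis
qed

text \<open>Beyond a disc around the drawing there is a single face, and it lies in
  \<open>\<Omega>\<close>. A set \<open>U s\<close> built with this face contains the far region and
  has distance \<open>0\<close>; any other stays within the disc, and its distance is cut off to
  \<open>1\<close>.\<close>

lemma g_constant_far_away:
  assumes out: "\<Omega> = outside (path_image c)"
  obtains R w where "\<And>z. norm z \<ge> R \<Longrightarrow> g z = w"
proof -
  obtain R where R: "R > 0" "drawn_set G D \<subseteq> ball 0 R"
    using compact_drawn_set compact_imp_bounded bounded_subset_ballD[of _ 0] by blast
  define S where "S = - ball (0::complex) R"
  have conS: "connected S" unfolding S_def
    by (rule connected_complement_bounded_convex) auto
  have SD: "S \<subseteq> - drawn_set G D" using R(2) by (auto simp: S_def)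
  have "\<not> bounded \<Omega>" using out Jordan_inside_outside[OF simple_c loop_c] by simp
  then obtain y where y: "y \<in> \<Omega>" "norm y > R" by (metis bounded_iff not_le)
  then have yS: "y \<in> S" by (simp add: S_def)
  obtain F where F: "F \<in> faces G D" "S \<subseteq> F"
    using exists_component_superset[OF SD _ conS] yS SD unfolding faces_def by blast
  have F\<Omega>: "F \<subseteq> \<Omega>" using face_in_side[OF F(1)] y yS F(2) by blast
  \<comment> \<open>The extra \<open>1\<close> in the radius makes the cut-off effective against
    every subset of \<open>cball 0 R\<close>.\<close>
  have "dist_U z s = (if (Face F, Vertex x) \<in> L s then 0 else 1)" if z: "norm z \<ge> R + 1" for z s
  proof (cases "(Face F, Vertex x) \<in> L s")
    case True
    have "z \<in> F" using F(2) z by (auto simp: S_def)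
    then have "z \<in> U s" using closure_face_subset_U[OF F(1) F\<Omega> True] closure_subset by blast
    then show ?thesis using True dist_U_eq_0_iff by simp
  next
    case False
    have "F' \<subseteq> ball 0 R" if "F' \<in> faces G D" "(Face F', Vertex x) \<in> L s" for F'
    proof -
      have "F' \<inter> F = {}"
        using that False F(1) components_nonoverlap[of F' _ F] unfolding faces_def by blast
      then show ?thesis using F(2) unfolding S_def by blast
    qed
    then have "\<Union>{F \<in> faces G D. F \<subseteq> \<Omega> \<and> (Face F, Vertex x) \<in> L s} \<subseteq> cball 0 R"
      using ball_subset_cball by blast
    then have Ub: "U s \<subseteq> cball 0 R" unfolding U_def by (rule closure_minimal) simp
    have "1 \<le> infdist z (U s)" if "U s \<noteq> {}"
    proof -
      have "1 \<le> dist z a" if "a \<in> U s" for a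
      proof -
        have "norm a \<le> R" using that Ub by auto
        then show ?thesis using z norm_triangle_ineq2[of z a] by (simp add: dist_norm)
      qed
      then show ?thesis using that by (simp add: infdist_def cINF_greatest)
    qed
    then show ?thesis using False by (auto simp: dist_U_def)
  qed
  then have "g z = proj3 (\<lambda>s. if (Face F, Vertex x) \<in> L s then 0 else 1)" if "norm z \<ge> R + 1" for z
    using that by (simp add: g_def proj3_def)
  then show thesis using that by blast
qed

lemma winding_number_g: "winding_number (g \<circ> c) 0 = 0"
proof -
  have "path c" using simple_c simple_path_imp_path by blast
  show ?thesis
  proof (cases "\<Omega> = inside (path_image c)")
    case True
    obtain l where "continuous_on (path_image c) l" "\<And>z. z \<in> path_image c \<Longrightarrow> g z = exp (l z)"
      using log_on_loop_from_inside[OF simple_c loop_c continuous_g, unfolded True[symmetric], OF g_nonzero]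
      by blast
    then show ?thesis using winding_number_zero_if_log[OF \<open>path c\<close> loop_c] by blast
  next
    case False
    then have out: "\<Omega> = outside (path_image c)" using side by blast
    obtain R w where Rw: "\<And>z. norm z \<ge> R \<Longrightarrow> g z = w" using g_constant_far_away[OF out] by blast
    obtain l where "continuous_on (path_image c) l" "\<And>z. z \<in> path_image c \<Longrightarrow> g z = exp (l z)"
      using log_on_loop_from_outside[OF simple_c loop_c continuous_g, unfolded out[symmetric],
        OF g_nonzero Rw] by blast
    then show ?thesis using winding_number_zero_if_log[OF \<open>path c\<close> loop_c] by blast
  qed
qed

text \<open>One index serves the whole edge: a face counted in \<open>U s\<close> near one inner
  point of \<open>e\<close> has all of \<open>e\<close> on its frontier, and it places
  \<open>e\<close> with both ends below \<open>x\<close> in \<open>L s\<close>. The parameter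
  \<open>1/2\<close> is an arbitrary inner one.\<close>

lemma edge_label:
  assumes e: "e \<in> E" "ends G e = {u, v}"
  obtains s where "path_image (curve D e) \<subseteq> U s" "rank s u < rank s x" "rank s v < rank s x"
proof -
  have eG: "e \<in> edges G" using e E by blast
  have uv: "u \<in> verts G" "v \<in> verts G" using ends_subset[OF eG] e(2) by auto
  have "point D ` ends G e \<subseteq> path_image c" using e(1) E path_image_curve[OF eG] by auto
  then have ne: "u \<noteq> x" "v \<noteq> x" using x e(2) by auto
  have "curve D e (1/2) \<in> path_image (curve D e)" by (auto simp: path_image_def)
  then have "curve D e (1/2) \<in> path_image c" using E e by auto
  then obtain s where s: "curve D e (1/2) \<in> U s" using U_covers by blast
  obtain r where r: "r > 0"
    "\<And>F. F \<in> faces G D \<Longrightarrow> F \<inter> ball (curve D e (1/2)) r \<noteq> {} \<Longrightarrow> incident_le G D (Edge e) (Face F)"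
    using nearby_faces_above_edge[OF eG, of "1/2"] by auto
  obtain F where F: "F \<in> faces G D" "F \<subseteq> \<Omega>" "(Face F, Vertex x) \<in> L s" "F \<inter> ball (curve D e (1/2)) r \<noteq> {}"
    using U_meets[OF s r(1)] .
  have eF: "incident_le G D (Edge e) (Face F)" using r(2) F by blast
  have "(Edge e, Vertex x) \<in> L s" using trans_L[OF incident_below[OF eF] F(3)] eG F(1) by simp
  then have "rank s u < rank s x" "rank s v < rank s x"
    using rank_vertex_above_cell[of "Edge e"] e eG uv ne x(1) by auto
  moreover have "closure F \<subseteq> U s" using closure_face_subset_U F(1-3) by blast
  then have "path_image (curve D e) \<subseteq> U s" using eF by (auto simp: frontier_def)
  ultimately show thesis using that by blast
qed

text \<open>Straight-line homotopy from \<open>g \<circ> c\<close> to the loop \<open>d\<close> seen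
  from \<open>x\<close>. Both are projections from three coordinates, so it suffices that the mixed
  vector never has equal entries: for \<open>k > 0\<close> its entry is negative at the label
  \<open>s0\<close> of the edge and positive at some \<open>s1\<close> where \<open>u\<close> ranks
  above \<open>x\<close>; for \<open>k = 0\<close> the three sets would share a point.\<close>

lemma winding_number_orthogonal_loop:
  assumes d: "path d" "pathfinish d = pathstart d"
    and cd: "\<And>t. t \<in> {0..1} \<Longrightarrow> \<exists>e\<in>E. \<exists>u v r. c t \<in> path_image (curve D e) \<and> ends G e = {u, v} \<and>
      0 \<le> r \<and> r \<le> 1 \<and> d t = proj3 (half_edge rank u v r)"
  shows "winding_number d (proj3 (\<lambda>s. rank s x)) = 0"
proof -
  let ?x = "proj3 (\<lambda>s. rank s x)" and ?d = "\<lambda>t. d t - proj3 (\<lambda>s. rank s x)"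
  have "path c" using simple_c simple_path_imp_path by blast
  have "winding_number ?d 0 = winding_number (g \<circ> c) 0"
  proof (rule winding_number_loops_linear_eq)
    show "path (g \<circ> c)" by (rule path_continuous_image[OF \<open>path c\<close> continuous_g])
    show "path ?d" using d(1) unfolding path_def by (intro continuous_intros)
    show "pathfinish (g \<circ> c) = pathstart (g \<circ> c)" using loop_c by (simp add: pathfinish_def pathstart_def)
    show "pathfinish ?d = pathstart ?d" using d(2) by (simp add: pathfinish_def pathstart_def)
    fix t :: real assume t: "t \<in> {0..1}"
    obtain e u v r where e: "e \<in> E" and ct: "c t \<in> path_image (curve D e)" and uv: "ends G e = {u, v}"
      and r: "0 \<le> r" "r \<le> 1" and dt: "d t = proj3 (half_edge rank u v r)"
      using cd[OF t] by blast
    have eG: "e \<in> edges G" using e E by blast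
    obtain s0 where s0: "path_image (curve D e) \<subseteq> U s0" "rank s0 u < rank s0 x" "rank s0 v < rank s0 x"
      using edge_label[OF e uv] .
    have t0: "dist_U (c t) s0 = 0" using s0(1) ct dist_U_eq_0_iff by blast
    have lt: "half_edge rank u v r s0 < rank s0 x" using half_edge_le[OF r, of rank u v s0] s0 by simp
    have "u \<in> verts G" "u \<noteq> x" using ends_subset[OF eG] uv s0(2) by auto
    then obtain s1 where "rank s1 x < rank s1 u" using rank_vertex_above_vertex x(1) by metis
    then have gt: "rank s1 x < half_edge rank u v r s1"
      using half_edge_ge[OF r(1), of rank s1 u v] by simp
    show "0 \<notin> closed_segment ((g \<circ> c) t) (?d t)"
    proof
      assume "0 \<in> closed_segment ((g \<circ> c) t) (?d t)"
      then obtain k where k: "0 \<le> k" "k \<le> 1" "0 = (1 - k) *\<^sub>R (g \<circ> c) t + k *\<^sub>R ?d t"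
        unfolding closed_segment_def by blast
      \<comment> \<open>Lifts the point on the segment to three coordinates, where vanishing means a
        constant vector \<open>b\<close>.\<close>
      have "proj3 (\<lambda>s. (1 - k) * dist_U (c t) s + k * (half_edge rank u v r s - rank s x)) =
          (1 - k) *\<^sub>R (g \<circ> c) t + k *\<^sub>R ?d t"
        by (simp add: g_def dt proj3_def complex_eq_iff algebra_simps)
      also have "\<dots> = proj3 (\<lambda>_. 0)" using k(3) by (simp add: proj3_def Complex_eq_0)
      finally obtain b where b: "\<And>s. (1 - k) * dist_U (c t) s + k * (half_edge rank u v r s - rank s x) = b"
        unfolding proj3_eq_iff by auto
      show False
      proof (cases "k = 0")
        case True
        then have "\<And>s. dist_U (c t) s = 0" using b t0 by (metis diff_zero mult_1 mult_zero_left add_0_right)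
        then show False using dist_U_eq_0_iff U_no_common_point by metis
      next
        case False
        then have "k > 0" using k(1) by simp
        then have "b < 0" using b[of s0] t0 lt mult_pos_neg[of k "half_edge rank u v r s0 - rank s0 x"] by simp
        moreover have "b > 0"
          using b[of s1] mult_nonneg_nonneg[of "1 - k" "dist_U (c t) s1"] dist_U_nonneg[of "c t" s1] k(2)
            mult_pos_pos[of k "half_edge rank u v r s1 - rank s1 x"] \<open>k > 0\<close> gt by linarith
        ultimately show False by simp
      qed
    qed
  qed
  then have "winding_number ?d 0 = 0" using winding_number_g by simp
  then show ?thesis by (simp add: winding_number_offset[of d ?x])
qed

end

section \<open>From the dimension bound to the contradiction\<close>

lemma order_dim_le_3_realizer:
  assumes "order_dim A r \<le> 3"
  obtains L :: "3 \<Rightarrow> 'a rel" where "\<And>s. linear_order_on A (L s)" "(\<Inter>s. L s) = r"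
proof -
  let ?N = "{enat (card \<L>) | \<L>. realizer A r \<L>}"
  have le: "Inf ?N \<le> 3" using assms by (simp add: order_dim_def)
  have ne: "?N \<noteq> {}"
  proof
    assume "?N = {}"
    then have "Inf ?N = \<infinity>" unfolding Inf_enat_def by simp
    then show False using le by simp
  qed
  \<comment> \<open>The infimum of a nonempty set of extended naturals is its least element, so it
    is the size of an actual realizer.\<close>
  then have "\<exists>n. n \<in> ?N" by blast
  then have "(LEAST n. n \<in> ?N) \<in> ?N" by (rule LeastI_ex)
  then have "Inf ?N \<in> ?N" using ne unfolding Inf_enat_def by simp
  then obtain \<L> where \<L>: "realizer A r \<L>" "Inf ?N = enat (card \<L>)" by blast
  then have "enat (card \<L>) \<le> enat 3" using le by (simp add: numeral_eq_enat)
  then have "card \<L> \<le> card (UNIV :: 3 set)" by simp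
  moreover have fin: "finite \<L>" "\<L> \<noteq> {}" using \<L> by (auto simp: realizer_def)
  ultimately obtain f :: "'a rel \<Rightarrow> 3" where "inj_on f \<L>" "f ` \<L> \<subseteq> UNIV"
    using card_le_inj[of \<L> "UNIV :: 3 set"] by auto
  \<comment> \<open>A surjection from the three indices: a realizer with fewer orders is listed with
    repetitions.\<close>
  then obtain L :: "3 \<Rightarrow> 'a rel" where L: "L ` UNIV = \<L>"
    using inj_on_iff_surj[OF fin(2), of "UNIV :: 3 set"] by auto
  show thesis
  proof (rule that)
    show "linear_order_on A (L s)" for s using \<L>(1) L by (auto simp: realizer_def)
    show "(\<Inter>s. L s) = r" using \<L>(1) L by (simp add: realizer_def)
  qed
qed

lemma no_three_realizer_of_theta:
  fixes G H :: "('v, 'e) multigraph"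
  assumes "three_realizer G D L" and sub: "subgraph H G"
    and subdiv: "is_subdivision H (complete_bipartite 2 3)"
  shows False
proof -
  interpret three_realizer G D L by fact
  obtain a b m xs es where ab: "a \<noteq> b"
    and th: "\<And>j. j < 3 \<Longrightarrow> graph_path H (xs j) (es j) \<and> hd (xs j) = a \<and> last (xs j) = b \<and> m j \<in> set (xs j) - {a, b}"
    and int: "\<And>j k. j < 3 \<Longrightarrow> k < 3 \<Longrightarrow> j \<noteq> k \<Longrightarrow> set (xs j) \<inter> set (xs k) = {a, b} \<and> set (es j) \<inter> set (es k) = {}"
    and eH: "edges H = (\<Union>j<3::nat. set (es j))"
    using theta_of_subdivision[OF subdiv] by metis
  have HG: "finite_multigraph H" "verts H \<subseteq> verts G" "edges H \<subseteq> edges G"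
    "\<And>e. e \<in> edges H \<Longrightarrow> ends H e = ends G e"
    using sub by (auto simp: subgraph_def)
  have gpH: "graph_path H (xs j) (es j)" if "j < 3" for j using th[OF that] by blast
  have gpG: "graph_path G (xs j) (es j)" if "j < 3" for j
  proof -
    have "es j ! i \<in> edges H" if "i < length (es j)" for i
      using gpH[OF \<open>j < 3\<close>] that unfolding graph_path_def by (meson nth_mem subsetD)
    then show ?thesis using gpH[OF that] HG unfolding graph_path_def by (metis subset_trans)
  qed
  have len: "length (xs j) = Suc (length (es j))" if "j < 3" for j
    using gpH[OF that] by (simp add: graph_path_def)
  have ne: "es j \<noteq> []" if "j < 3" for j
  proof
    assume "es j = []"
    then have "length (xs j) = 1" using len[OF that] by simp
    then have "hd (xs j) = last (xs j)" by (auto simp: length_Suc_conv)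
    then show False using th[OF that] ab by auto
  qed
  have abH: "a \<in> verts H" "b \<in> verts H" and mH: "\<And>j. j < 3 \<Longrightarrow> m j \<in> verts H"
  proof -
    have xsH: "set (xs j) \<subseteq> verts H" if "j < 3" for j using gpH[OF that] by (simp add: graph_path_def)
    have "{a, b} \<subseteq> set (xs 0)" using int[of 0 1] by auto
    then show "a \<in> verts H" "b \<in> verts H" using xsH[of 0] by auto
    show "m j \<in> verts H" if "j < 3" for j using th[OF that] xsH[OF that] by auto
  qed
  have edge_nth: "\<exists>j<3. \<exists>i<length (es j). e = es j ! i \<and> ends H e = {xs j ! i, xs j ! Suc i}"
    if eE: "e \<in> edges H" for e
  proof -
    obtain j where "j < 3" "e \<in> set (es j)" using eE unfolding eH by blast
    moreover then obtain i where "i < length (es j)" "e = es j ! i" by (metis in_set_conv_nth)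
    ultimately show ?thesis using gpH[of j] unfolding graph_path_def by blast
  qed
  have loopless: "card (ends H e) = 2" if eE: "e \<in> edges H" for e
  proof -
    obtain j i where ji: "j < 3" "i < length (es j)" "ends H e = {xs j ! i, xs j ! Suc i}"
      using edge_nth[OF eE] by blast
    have "distinct (xs j)" using gpH[OF ji(1)] by (simp add: graph_path_def)
    then have "xs j ! i \<noteq> xs j ! Suc i" using ji(2) len[OF ji(1)] by (simp add: nth_eq_iff_index_eq)
    then show ?thesis using ji(3) by simp
  qed
  have no_parallel: "e = e'" if e: "e \<in> edges H" "e' \<in> edges H" "ends H e = ends H e'" for e e'
  proof -
    obtain j i where ji: "j < 3" "i < length (es j)" "e = es j ! i" "ends H e = {xs j ! i, xs j ! Suc i}"
      using edge_nth[OF e(1)] by blast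
    obtain k l where kl: "k < 3" "l < length (es k)" "e' = es k ! l" "ends H e' = {xs k ! l, xs k ! Suc l}"
      using edge_nth[OF e(2)] by blast
    have dist: "distinct (xs j)" using gpH[OF ji(1)] by (simp add: graph_path_def)
    show ?thesis
    proof (cases "j = k")
      case True
      then have "{xs j ! i, xs j ! Suc i} = {xs j ! l, xs j ! Suc l}" using ji kl e(3) by simp
      then have "i = l" using nth_eq_iff_index_eq[OF dist] ji(2) kl(2) True len[OF ji(1)]
        by (auto simp: doubleton_eq_iff)
      then show ?thesis using ji kl True by simp
    next
      case False
      \<comment> \<open>Distinct paths share only \<open>a\<close> and \<open>b\<close>. A parallel
        pair across them would join these two, so path \<open>j\<close> would be a single edge,
        without room for its inner vertex \<open>m j\<close>.\<close>
      have "ends H e \<subseteq> set (xs j) \<inter> set (xs k)"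
        using graph_path_ends_subset[OF gpH[OF ji(1)], of e] graph_path_ends_subset[OF gpH[OF kl(1)], of e']
          ji kl e(3) by auto
      then have "ends H e \<subseteq> {a, b}" using int[OF ji(1) kl(1) False] by simp
      moreover have "card {a, b} = 2" using ab by simp
      ultimately have "{xs j ! i, xs j ! Suc i} = {a, b}"
        using loopless[OF e(1)] ji(4) card_subset_eq[of "{a, b}" "ends H e"] by simp
      moreover have "a = xs j ! 0" "b = xs j ! length (es j)"
        using th[OF ji(1)] len[OF ji(1)] hd_conv_nth[of "xs j"] last_conv_nth[of "xs j"] by force+
      ultimately have "length (es j) = 1"
        using nth_eq_iff_index_eq[OF dist] ji(2) len[OF ji(1)] by (auto simp: doubleton_eq_iff)
      then have "length (xs j) = 2" using len[OF ji(1)] by simp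
      then obtain y z where "xs j = [y, z]" by (auto simp: length_Suc_conv numeral_2_eq_2)
      then show ?thesis using th[OF ji(1)] by auto
    qed
  qed
  interpret oc: order_coordinates H rank
  proof
    show "e \<in> edges H \<Longrightarrow> card (ends H e) = 2" for e by (rule loopless)
    show "e \<in> edges H \<Longrightarrow> e' \<in> edges H \<Longrightarrow> ends H e = ends H e' \<Longrightarrow> e = e'" for e e' by (rule no_parallel)
    \<comment> \<open>The ranks count vertices of \<open>G\<close>, but the required inequalities
      restrict to the subgraph.\<close>
    show "v \<in> verts H \<Longrightarrow> w \<in> verts H \<Longrightarrow> v \<noteq> w \<Longrightarrow> \<exists>s. rank s w < rank s v" for v w
      using rank_vertex_above_vertex HG(2) by blast
    show "\<exists>s. max (rank s u) (rank s v) < rank s w"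
      if "e \<in> edges H" "ends H e = {u, v}" "w \<in> verts H" "w \<notin> {u, v}" for e u v w
      using rank_vertex_above_edge[of e u v w] that HG by auto
  qed (use HG(1) in \<open>simp_all add: finite_multigraph_def\<close>)
  define D' where "D' = orthogonal_drawing H rank"
  interpret pm: planar_map H D' unfolding D'_def by (rule oc.planar_map_orthogonal_drawing)
  define c where "c j = path_curve D (xs j) (es j)" for j
  define d where "d j = path_curve D' (xs j) (es j)" for j
  have c: "arc (c j)" "pathstart (c j) = point D a" "pathfinish (c j) = point D b"
    "path_image (c j) = (\<Union>e\<in>set (es j). path_image (curve D e))" if "j < 3" for j
    using path_curve[OF gpG ne, OF that that] th[OF that] by (auto simp: c_def)
  have d: "arc (d j)" "pathstart (d j) = point D' a" "pathfinish (d j) = point D' b" if "j < 3" for j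
    using pm.path_curve[OF gpH ne, OF that that] th[OF that] by (auto simp: d_def)
  have c_int: "path_image (c i) \<inter> path_image (c j) = {point D a, point D b}" if "i < 3" "j < 3" "i \<noteq> j" for i j
  proof
    show "path_image (c i) \<inter> path_image (c j) \<subseteq> {point D a, point D b}"
      using path_curve_Int[OF gpG ne gpG ne, OF that(1,1,2,2)] int[OF that] by (auto simp: c_def)
    show "{point D a, point D b} \<subseteq> path_image (c i) \<inter> path_image (c j)"
      using c(2,3) that pathstart_in_path_image pathfinish_in_path_image by (metis IntI empty_subsetI insert_subset)
  qed
  have d_int: "path_image (d i) \<inter> path_image (d j) = {point D' a, point D' b}" if "i < 3" "j < 3" "i \<noteq> j" for i j
  proof
    show "path_image (d i) \<inter> path_image (d j) \<subseteq> {point D' a, point D' b}"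
      using pm.path_curve_Int[OF gpH ne gpH ne, OF that(1,1,2,2)] int[OF that] by (auto simp: d_def)
    show "{point D' a, point D' b} \<subseteq> path_image (d i) \<inter> path_image (d j)"
      using d(2,3) that pathstart_in_path_image pathfinish_in_path_image by (metis IntI empty_subsetI insert_subset)
  qed
  have on_d: "point D' (m k) \<in> path_image (d k) - {point D' a, point D' b}" if k: "k < 3" for k
  proof -
    have "point D' (m k) \<in> path_image (d k)"
      using pm.point_in_path_curve_iff[OF gpH[OF k] ne[OF k] mH[OF k]] th[OF k] by (simp add: d_def)
    then show ?thesis using th[OF k] mH[OF k] abH pm.inj_point by (auto simp: inj_on_def)
  qed
  have wind: "winding_number (d i +++ reversepath (d j)) (point D' (m k)) = 0"
    if ijk: "i < 3" "j < 3" "k < 3" "i \<noteq> j" "i \<noteq> k" "j \<noteq> k" for i j k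
  proof -
    note loop = loop_of_arcs[OF c(1)[OF ijk(1)] c(1)[OF ijk(2)] c(2,3)[OF ijk(1)] c(2,3)[OF ijk(2)]
        c_int[OF ijk(1,2,4)]]
    \<comment> \<open>The side is chosen in the given drawing, whereas the winding number is taken
      in the coordinate drawing.\<close>
    define \<Omega> where "\<Omega> = (if point D (m k) \<in> inside (path_image (c i +++ reversepath (c j)))
      then outside (path_image (c i +++ reversepath (c j))) else inside (path_image (c i +++ reversepath (c j))))"
    have off: "point D (m k) \<notin> path_image (c l)" if l: "l < 3" "l \<noteq> k" for l
    proof -
      have "m k \<notin> set (xs l)" using th[OF ijk(3)] int[OF l(1) ijk(3) l(2)] by blast
      then show ?thesis
        using point_in_path_curve_iff[OF gpG[OF l(1)] ne[OF l(1)], of "m k"] mH[OF ijk(3)] HG(2)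
        by (auto simp: c_def)
    qed
    interpret cycle_avoiding G D L "c i +++ reversepath (c j)" "set (es i) \<union> set (es j)" "m k" \<Omega>
    proof
      show "set (es i) \<union> set (es j) \<subseteq> edges G" using gpG ijk by (simp add: graph_path_def)
      show "path_image (c i +++ reversepath (c j)) = (\<Union>e\<in>set (es i) \<union> set (es j). path_image (curve D e))"
        using c(4) ijk by (simp add: loop(3))
      show "m k \<in> verts G" using mH ijk HG(2) by blast
      show "point D (m k) \<notin> path_image (c i +++ reversepath (c j))"
        using off ijk by (simp add: loop(3))
      show "point D (m k) \<notin> \<Omega>"
        using inside_Int_outside[of "path_image (c i +++ reversepath (c j))"] unfolding \<Omega>_def
        by (auto simp del: inside_Int_outside)
    qed (use loop(1,2) in \<open>auto simp: \<Omega>_def\<close>)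
    have "winding_number (d i +++ reversepath (d j)) (proj3 (\<lambda>s. rank s (m k))) = 0"
    proof (rule winding_number_orthogonal_loop)
      show "path (d i +++ reversepath (d j))"
        using d ijk by (simp add: arc_imp_path path_join)
      show "pathfinish (d i +++ reversepath (d j)) = pathstart (d i +++ reversepath (d j))"
        using d ijk by simp
      fix t :: real assume t: "t \<in> {0..1}"
      obtain e where e: "e \<in> set (es i) \<union> set (es j)"
        "(c i +++ reversepath (c j)) t \<in> path_image (curve D e)"
        "(d i +++ reversepath (d j)) t \<in> path_image (curve D' e)"
      proof (cases "t \<le> 1/2")
        case True
        then show thesis
          using that path_curve_same_edge[OF len[OF ijk(1)] ne[OF ijk(1)], of "2 * t" D D'] t
          by (auto simp: joinpaths_def c_def d_def)
      next
        case False
        then show thesis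
          \<comment> \<open>On its second half the loop runs backwards along path \<open>j\<close>:
            the join rescales to \<open>2 * t - 1\<close> and the reversal takes \<open>1\<close>
            minus that, identically in both drawings.\<close>
          using that path_curve_same_edge[OF len[OF ijk(2)] ne[OF ijk(2)], of "1 - (2 * t - 1)" D D'] t
          by (auto simp: joinpaths_def reversepath_def c_def d_def)
      qed
      have eH': "e \<in> edges H" using e(1) eH ijk by auto
      obtain y where y: "y \<in> {0..1}" "(d i +++ reversepath (d j)) t = curve D' e y"
        using e(3) by (auto simp: path_image_def)
      obtain u v r where "ends H e = {u, v}" "0 \<le> r" "r \<le> 1" "curve D' e y = proj3 (half_edge rank u v r)"
        using oc.curve_orthogonal_point[OF eH', of y] y(1) unfolding D'_def atLeastAtMost_iff by metis
      then show "\<exists>e\<in>set (es i) \<union> set (es j). \<exists>u v r. (c i +++ reversepath (c j)) t \<in> path_image (curve D e) \<and>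
          ends G e = {u, v} \<and> 0 \<le> r \<and> r \<le> 1 \<and> (d i +++ reversepath (d j)) t = proj3 (half_edge rank u v r)"
        using e(1,2) y(2) HG(4)[OF eH'] by metis
    qed
    then show ?thesis by (simp add: D'_def orthogonal_drawing_def)
  qed
  show False
  proof (rule theta_curve_not_all_arcs_outside[of "d 0" "d 1" "d 2" "point D' a" "point D' b"
        "point D' (m 0)" "point D' (m 1)" "point D' (m 2)"])
  qed (use d d_int on_d wind in simp_all)
qed

theorem theorem2p3:
  fixes G :: "('v, 'e) multigraph" and D :: "('v, 'e) drawing"
  assumes "planar_map G D"
    and "\<exists>H. subgraph H G \<and> is_subdivision H (complete_bipartite 2 3)"
  shows "order_dim (cells G D) (P_VEF G D) > 3"
proof (rule ccontr)
  assume "\<not> ?thesis"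
  then have "order_dim (cells G D) (P_VEF G D) \<le> 3" by simp
  then obtain L :: "3 \<Rightarrow> ('v, 'e) cell rel"
    where "\<And>s. linear_order_on (cells G D) (L s)" "(\<Inter>s. L s) = P_VEF G D"
    using order_dim_le_3_realizer by blast
  then have "three_realizer G D L"
    using assms(1) by (simp add: three_realizer_def three_realizer_axioms_def)
  then show False using no_three_realizer_of_theta assms(2) by blast
qed

end
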